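(* Let $f$ be a $C^1$-diffeomorphism of a manifold $M$ and let $K\subset M$ be a compact $f$-invariant set which is partially hyperbolic, with splitting $TM|_K=E^c\oplus E^{uu}$. Let $S\subset M$ be a compact $C^1$-submanifold with boundary which contains $K$ in its interior, satisfies $T_xS=E^c(x)$ for each $x\in K$, and is locally invariant, i.e. $f(S)\cap S$ contains a neighborhood of $K$ in $S$. Then there is a neighborhood $U$ of $K$ in $M$ such that the maximal invariant set $\Lambda=\bigcap_{n\in\mathbb{Z}}f^n(U)$ of $f$ in $U$ is contained in the interior of $S$.
   Context: $M$ is endowed with a Riemannian metric. A $Df$-invariant splitting $TM|_K=E^c\oplus E^{uu}$ over an $f$-invariant compact set $K$ is partially hyperbolic with strong unstable direction $E^{uu}$ if there are constants $\lambda_K>1$ and $C>0$ such that for each $x\in K$, all unit vectors $u\in E^c(x)$, $v\in E^{uu}(x)$ and each $n\ge 1$: $\|Df^n(x)\cdot v\|>C\lambda_K^n$ and $\|Df^n(x)\cdot v\|>C\lambda_K^n\|Df^n(x)\cdot u\|$. The interior of $S$ is its interior as a manifold with boundary. *)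

theory Defs
  imports "HOL-Analysis.Analysis"
begin

section \<open>Maps of class C^k between Euclidean spaces\<close>

text \<open>Only meant for open \<open>S\<close>. In finite dimension, continuity (or C^k regularity) of
  the derivative is the same as that of all the maps \<open>x \<mapsto> f' x v\<close>.\<close>

primrec Ck_on :: "nat \<Rightarrow> ('a::euclidean_space \<Rightarrow> 'b::real_normed_vector) \<Rightarrow> 'a set \<Rightarrow> bool" where
  "Ck_on 0 f S \<longleftrightarrow> continuous_on S f"
| "Ck_on (Suc k) f S \<longleftrightarrow>
     (\<exists>f'. (\<forall>x\<in>S. (f has_derivative f' x) (at x)) \<and> (\<forall>v. Ck_on k (\<lambda>x. f' x v) S))"

definition smooth_on :: "('a::euclidean_space \<Rightarrow> 'b::real_normed_vector) \<Rightarrow> 'a set \<Rightarrow> bool" where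
  "smooth_on f S \<longleftrightarrow> (\<forall>k. Ck_on k f S)"


section \<open>Smooth manifolds\<close>

text \<open>The points of the manifold form a whole type \<open>'m\<close>, which is assumed to be Hausdorff and
  second countable through its type classes; \<open>'e\<close> is the model space. A chart is a pair
  of a domain and a map, and the values of the map outside the domain are irrelevant.\<close>

type_synonym ('m, 'e) chart = "'m set \<times> ('m \<Rightarrow> 'e)"

definition is_chart :: "('m::topological_space, 'e::euclidean_space) chart \<Rightarrow> bool" where
  "is_chart c \<longleftrightarrow> open (fst c) \<and> open (snd c ` fst c) \<and>
     (\<exists>h. homeomorphism (fst c) (snd c ` fst c) (snd c) h)"

definition chart_inv :: "('m, 'e) chart \<Rightarrow> 'e \<Rightarrow> 'm" where
  "chart_inv c = inv_into (fst c) (snd c)"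

definition local_rep :: "('m, 'e) chart \<Rightarrow> ('m, 'e) chart \<Rightarrow> ('m \<Rightarrow> 'm) \<Rightarrow> 'e \<Rightarrow> 'e" where
  "local_rep c c' f = snd c' \<circ> f \<circ> chart_inv c"

definition smooth_atlas ::
  "('m::{t2_space,second_countable_topology}, 'e::euclidean_space) chart set \<Rightarrow> bool" where
  "smooth_atlas A \<longleftrightarrow> (\<forall>c\<in>A. is_chart c) \<and> (\<Union>c\<in>A. fst c) = UNIV \<and>
     (\<forall>c\<in>A. \<forall>c'\<in>A. smooth_on (local_rep c c' id) (snd c ` (fst c \<inter> fst c')))"

definition C1_map ::
  "('m::topological_space, 'e::euclidean_space) chart set \<Rightarrow> ('m \<Rightarrow> 'm) \<Rightarrow> bool" where
  "C1_map A f \<longleftrightarrow> continuous_on UNIV f \<and>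
     (\<forall>c\<in>A. \<forall>c'\<in>A. Ck_on 1 (local_rep c c' f) (snd c ` (fst c \<inter> f -` fst c')))"

definition C1_diffeomorphism ::
  "('m::topological_space, 'e::euclidean_space) chart set \<Rightarrow> ('m \<Rightarrow> 'm) \<Rightarrow> bool" where
  "C1_diffeomorphism A f \<longleftrightarrow> bij f \<and> C1_map A f \<and> C1_map A (inv f)"


section \<open>Tangent spaces, derivatives and Riemannian metrics\<close>

text \<open>A tangent vector at \<open>p\<close> is represented by its components in one chart at \<open>p\<close>,
  selected once and for all; thus every tangent space is a copy of the model space \<open>'e\<close>.\<close>

definition chart_at :: "('m, 'e) chart set \<Rightarrow> 'm \<Rightarrow> ('m, 'e) chart" where
  "chart_at A p = (SOME c. c \<in> A \<and> p \<in> fst c)"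

definition tangent_map ::
  "('m, 'e::euclidean_space) chart set \<Rightarrow> ('m \<Rightarrow> 'm) \<Rightarrow> 'm \<Rightarrow> 'e \<Rightarrow> 'e" where
  "tangent_map A f p = frechet_derivative (local_rep (chart_at A p) (chart_at A (f p)) f)
     (at (snd (chart_at A p) p))"

text \<open>\<open>chart_deriv A c p\<close> sends a tangent vector at \<open>p\<close> to its components in the
  chart \<open>c\<close>; \<open>chart_vector A c p\<close> is its inverse.\<close>

definition chart_deriv ::
  "('m, 'e::euclidean_space) chart set \<Rightarrow> ('m, 'e) chart \<Rightarrow> 'm \<Rightarrow> 'e \<Rightarrow> 'e" where
  "chart_deriv A c p = frechet_derivative (local_rep (chart_at A p) c id)
     (at (snd (chart_at A p) p))"

definition chart_vector ::
  "('m, 'e::euclidean_space) chart set \<Rightarrow> ('m, 'e) chart \<Rightarrow> 'm \<Rightarrow> 'e \<Rightarrow> 'e" where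
  "chart_vector A c p = frechet_derivative (local_rep c (chart_at A p) id) (at (snd c p))"

definition riemannian_metric ::
  "('m, 'e::euclidean_space) chart set \<Rightarrow> ('m \<Rightarrow> 'e \<Rightarrow> 'e \<Rightarrow> real) \<Rightarrow> bool" where
  "riemannian_metric A g \<longleftrightarrow>
     (\<forall>p. bilinear (g p) \<and> (\<forall>u v. g p u v = g p v u) \<and> (\<forall>v. v \<noteq> 0 \<longrightarrow> g p v v > 0)) \<and>
     (\<forall>c\<in>A. \<forall>a b. smooth_on
        (\<lambda>z. g (chart_inv c z) (chart_vector A c (chart_inv c z) a)
                               (chart_vector A c (chart_inv c z) b))
        (snd c ` fst c))"

definition metric_norm :: "('m \<Rightarrow> 'e \<Rightarrow> 'e \<Rightarrow> real) \<Rightarrow> 'm \<Rightarrow> 'e \<Rightarrow> real" where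
  "metric_norm g p v = sqrt (g p v v)"


section \<open>Partial hyperbolicity\<close>

definition invariant_splitting ::
  "('m, 'e::euclidean_space) chart set \<Rightarrow> ('m \<Rightarrow> 'm) \<Rightarrow> 'm set
     \<Rightarrow> ('m \<Rightarrow> 'e set) \<Rightarrow> ('m \<Rightarrow> 'e set) \<Rightarrow> bool" where
  "invariant_splitting A f K Ec Eu \<longleftrightarrow>
     (\<forall>x\<in>K. subspace (Ec x) \<and> subspace (Eu x) \<and>
        Ec x \<inter> Eu x = {0} \<and> {u + v | u v. u \<in> Ec x \<and> v \<in> Eu x} = UNIV \<and>
        tangent_map A f x ` Ec x = Ec (f x) \<and> tangent_map A f x ` Eu x = Eu (f x))"

definition partially_hyperbolic ::
  "('m, 'e::euclidean_space) chart set \<Rightarrow> ('m \<Rightarrow> 'e \<Rightarrow> 'e \<Rightarrow> real) \<Rightarrow> ('m \<Rightarrow> 'm) \<Rightarrow> 'm set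
     \<Rightarrow> ('m \<Rightarrow> 'e set) \<Rightarrow> ('m \<Rightarrow> 'e set) \<Rightarrow> bool" where
  "partially_hyperbolic A g f K Ec Eu \<longleftrightarrow>
     invariant_splitting A f K Ec Eu \<and>
     (\<exists>l>1. \<exists>C>0.
        (\<forall>x\<in>K. \<forall>v\<in>Eu x. \<forall>n\<ge>1. metric_norm g x v = 1 \<longrightarrow>
           metric_norm g ((f ^^ n) x) (tangent_map A (f ^^ n) x v) > C * l ^ n) \<and>
        (\<forall>x\<in>K. \<forall>u\<in>Ec x. \<forall>v\<in>Eu x. \<forall>n\<ge>1. metric_norm g x u = 1 \<and> metric_norm g x v = 1 \<longrightarrow>
           metric_norm g ((f ^^ n) x) (tangent_map A (f ^^ n) x v)
             > C * l ^ n * metric_norm g ((f ^^ n) x) (tangent_map A (f ^^ n) x u)))"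


section \<open>Submanifolds with boundary\<close>

definition C1_chart ::
  "('m::topological_space, 'e::euclidean_space) chart set \<Rightarrow> ('m, 'e) chart \<Rightarrow> bool" where
  "C1_chart A c \<longleftrightarrow> is_chart c \<and>
     (\<forall>c'\<in>A. Ck_on 1 (local_rep c c' id) (snd c ` (fst c \<inter> fst c')) \<and>
             Ck_on 1 (local_rep c' c id) (snd c' ` (fst c \<inter> fst c')))"

text \<open>In the chart \<open>c\<close> the set \<open>S\<close> is the half-space \<open>{z \<in> V. z \<bullet> w \<ge> 0}\<close> of the
  \<open>d\<close>-dimensional linear space \<open>V\<close>; it is all of \<open>V\<close> if \<open>w = 0\<close>.\<close>

definition slice_chart ::
  "('m::topological_space, 'e::euclidean_space) chart set \<Rightarrow> nat \<Rightarrow> 'm set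
     \<Rightarrow> ('m, 'e) chart \<Rightarrow> 'e set \<Rightarrow> 'e \<Rightarrow> bool" where
  "slice_chart A d S c V w \<longleftrightarrow> C1_chart A c \<and> subspace V \<and> dim V = d \<and> w \<in> V \<and>
     snd c ` (S \<inter> fst c) = {z \<in> V. z \<bullet> w \<ge> 0} \<inter> snd c ` fst c"

definition C1_submanifold_with_boundary ::
  "('m::topological_space, 'e::euclidean_space) chart set \<Rightarrow> nat \<Rightarrow> 'm set \<Rightarrow> bool" where
  "C1_submanifold_with_boundary A d S \<longleftrightarrow>
     (\<forall>p\<in>S. \<exists>c V w. p \<in> fst c \<and> slice_chart A d S c V w)"

definition manifold_interior ::
  "('m::topological_space, 'e::euclidean_space) chart set \<Rightarrow> nat \<Rightarrow> 'm set \<Rightarrow> 'm set" where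
  "manifold_interior A d S = {p \<in> S. \<exists>c V. p \<in> fst c \<and> slice_chart A d S c V 0}"

text \<open>The choice of the slice chart does not matter.\<close>

definition tangent_space_of ::
  "('m::topological_space, 'e::euclidean_space) chart set \<Rightarrow> nat \<Rightarrow> 'm set \<Rightarrow> 'm \<Rightarrow> 'e set" where
  "tangent_space_of A d S p =
     {v. \<exists>c V w. p \<in> fst c \<and> slice_chart A d S c V w \<and> chart_deriv A c p v \<in> V}"


section \<open>Local invariance and maximal invariant sets\<close>

definition locally_invariant ::
  "('m::topological_space \<Rightarrow> 'm) \<Rightarrow> 'm set \<Rightarrow> 'm set \<Rightarrow> bool" where
  "locally_invariant f K S \<longleftrightarrow>
     (\<exists>W. openin (top_of_set S) W \<and> K \<subseteq> W \<and> W \<subseteq> f ` S \<inter> S)"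

definition int_iterate :: "('m \<Rightarrow> 'm) \<Rightarrow> int \<Rightarrow> 'm \<Rightarrow> 'm" where
  "int_iterate f n = (if n \<ge> 0 then f ^^ nat n else inv f ^^ nat (- n))"

definition maximal_invariant_set :: "('m \<Rightarrow> 'm) \<Rightarrow> 'm set \<Rightarrow> 'm set" where
  "maximal_invariant_set f U = (\<Inter>n. int_iterate f n ` U)"

end

theory Submission
  imports Defs
begin

text \<open>The submanifold \<open>S\<close> is repelling in the direction \<open>Eu\<close>, so a point off \<open>S\<close> cannot stay near \<open>K\<close>.

  In a slice chart \<open>S\<close> is a piece of a linear space \<open>V\<close>, and the distance of a point to \<open>S\<close> is measured
  there by the distance of its coordinates to \<open>V\<close>. By local invariance, \<open>N\<close> backward iterates map
  the part of \<open>S\<close> near \<open>K\<close> into \<open>S\<close>. Their derivative at a point of \<open>K\<close>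
  maps \<open>Ec\<close>, the tangent space of \<open>S\<close>, to \<open>Ec\<close>, and contracts \<open>Eu\<close>, which is a complement.
  Hence, for \<open>N\<close> large, it halves the distance to \<open>S\<close> of all points near \<open>K\<close>
  (\<open>transverse_contraction\<close>, \<open>slice_distance_halved\<close>). Equivalently the distance to \<open>S\<close> at least doubles
  along each \<open>N\<close> forward iterates as long as the orbit stays near \<open>K\<close>, and as it
  remains bounded, it is 0. The point is then in the domain of a slice chart without boundary and in \<open>S\<close>, that is,
  in the interior of \<open>S\<close>.

  For a single \<open>N\<close> to serve all of \<open>K\<close>, the Riemannian norm must be uniformly comparable with the norms in
  finitely many slice charts, which is a matter of compactness (\<open>metric_chart_comparison\<close>), and the
  angle between \<open>Ec\<close> and \<open>Eu\<close> must be bounded from below. The latter follows from the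
  domination of \<open>Ec\<close> by \<open>Eu\<close> (\<open>splitting_angle\<close>).

  A point of an orbit may lie in several of the slice charts. The halving estimate is therefore
  stated for every chart of the image point and for a suitable chart of the preimage, and the charts
  are restricted to closed boxes that cover \<open>K\<close> by their interiors, so that near a point of
  \<open>K\<close> only the charts whose boxes contain that point matter.\<close>

section \<open>Maps of class C^1 near a point\<close>

text \<open>Regularity is localised at a point, so that chart domains do not have to be carried
  through compositions.\<close>

definition C1_at :: "('a::euclidean_space \<Rightarrow> 'b::real_normed_vector) \<Rightarrow> 'a \<Rightarrow> bool" where
  "C1_at h x \<longleftrightarrow> (\<exists>T. open T \<and> x \<in> T \<and> Ck_on 1 h T)"

lemma Ck_on_1_iff:
  "Ck_on 1 h T \<longleftrightarrow> (\<exists>h'. (\<forall>x\<in>T. (h has_derivative h' x) (at x)) \<and>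
     (\<forall>v. continuous_on T (\<lambda>x. h' x v)))"
  by (simp add: One_nat_def)

lemma C1_atE:
  assumes "C1_at h x"
  obtains T h' where "open T" "x \<in> T" "\<And>z. z \<in> T \<Longrightarrow> (h has_derivative h' z) (at z)"
    "\<And>v. continuous_on T (\<lambda>z. h' z v)"
  using assms unfolding C1_at_def Ck_on_1_iff by blast

lemma C1_atI:
  assumes "open T" "x \<in> T" "\<And>z. z \<in> T \<Longrightarrow> (h has_derivative h' z) (at z)"
    "\<And>v. continuous_on T (\<lambda>z. h' z v)"
  shows "C1_at h x"
  using assms unfolding C1_at_def Ck_on_1_iff by blast

text \<open>In finite dimension a family of linear maps that depends continuously on the parameter
  for each fixed vector is jointly continuous: expand the vector in a basis.\<close>

lemma continuous_on_linear_family: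
  fixes L :: "'a::topological_space \<Rightarrow> 'b::euclidean_space \<Rightarrow> 'c::real_normed_vector"
  assumes lin: "\<And>z. z \<in> T \<Longrightarrow> linear (L z)"
    and cont: "\<And>v. continuous_on T (\<lambda>z. L z v)"
    and w: "continuous_on T w"
  shows "continuous_on T (\<lambda>z. L z (w z))"
proof -
  have "L z (w z) = (\<Sum>b\<in>Basis. (w z \<bullet> b) *\<^sub>R L z b)" if "z \<in> T" for z
  proof -
    have "L z (w z) = L z (\<Sum>b\<in>Basis. (w z \<bullet> b) *\<^sub>R b)"
      by (simp add: euclidean_representation)
    also have "\<dots> = (\<Sum>b\<in>Basis. (w z \<bullet> b) *\<^sub>R L z b)"
      using lin[OF that] by (simp add: linear_sum linear_cmul)
    finally show ?thesis .
  qed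
  moreover have "continuous_on T (\<lambda>z. \<Sum>b\<in>Basis. (w z \<bullet> b) *\<^sub>R L z b)"
    by (intro continuous_intros w cont)
  ultimately show ?thesis
    by (simp cong: continuous_on_cong)
qed

lemma C1_at_cong:
  assumes "C1_at h x" "open T" "x \<in> T" "\<And>z. z \<in> T \<Longrightarrow> h z = k z"
  shows "C1_at k x"
proof -
  obtain U h' where U: "open U" "x \<in> U" "\<And>z. z \<in> U \<Longrightarrow> (h has_derivative h' z) (at z)"
    "\<And>v. continuous_on U (\<lambda>z. h' z v)"
    using C1_atE[OF assms(1)] by blast
  show ?thesis
  proof (rule C1_atI[of "U \<inter> T" _ _ h'])
    show "(k has_derivative h' z) (at z)" if "z \<in> U \<inter> T" for z
      using that U(3) assms(2,4) has_derivative_transform_within_open by blast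
    show "continuous_on (U \<inter> T) (\<lambda>z. h' z v)" for v
      using U(4) continuous_on_subset by blast
  qed (use U assms in auto)
qed

lemma C1_at_compose:
  fixes h :: "'a::euclidean_space \<Rightarrow> 'b::euclidean_space"
    and k :: "'b \<Rightarrow> 'c::real_normed_vector"
  assumes "C1_at h x" "C1_at k (h x)"
  shows "C1_at (k \<circ> h) x"
proof -
  obtain T h' where T: "open T" "x \<in> T" "\<And>z. z \<in> T \<Longrightarrow> (h has_derivative h' z) (at z)"
    "\<And>v. continuous_on T (\<lambda>z. h' z v)"
    using C1_atE[OF assms(1)] by blast
  obtain U k' where U: "open U" "h x \<in> U" "\<And>z. z \<in> U \<Longrightarrow> (k has_derivative k' z) (at z)"
    "\<And>v. continuous_on U (\<lambda>z. k' z v)"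
    using C1_atE[OF assms(2)] by blast
  have hT: "continuous_on T h"
    using T(3) has_derivative_continuous_on has_derivative_at_withinI by blast
  let ?W = "T \<inter> h -` U"
  have W: "open ?W" using hT T(1) U(1) continuous_open_preimage by blast
  have hW: "continuous_on ?W h" using hT continuous_on_subset by blast
  show ?thesis
  proof (rule C1_atI[of ?W _ _ "\<lambda>z. k' (h z) \<circ> h' z"])
    show "(k \<circ> h has_derivative k' (h z) \<circ> h' z) (at z)" if "z \<in> ?W" for z
      using that T(3) U(3) diff_chain_at by blast
    have "continuous_on ?W (\<lambda>z. k' (h z) (h' z v))" for v
    proof (rule continuous_on_linear_family)
      show "linear (k' (h z))" if "z \<in> ?W" for z
        using that U(3) has_derivative_linear by blast
      show "continuous_on ?W (\<lambda>z. k' (h z) v)" for v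
        using continuous_on_compose2[OF U(4) hW] by blast
      show "continuous_on ?W (\<lambda>z. h' z v)" using T(4) continuous_on_subset by blast
    qed
    then show "continuous_on ?W (\<lambda>z. (k' (h z) \<circ> h' z) v)" for v by (simp add: o_def)
  qed (use W T U in auto)
qed

lemma C1_at_has_derivative:
  assumes "C1_at h x"
  shows "(h has_derivative frechet_derivative h (at x)) (at x)"
  using assms by (metis C1_atE frechet_derivative_at)

text \<open>Continuity of the derivative in the operator norm, again by expansion in a basis.\<close>

lemma C1_at_derivative_close:
  assumes "C1_at h x" "e > 0"
  obtains r where "r > 0" "\<And>z. z \<in> ball x r \<Longrightarrow> C1_at h z"
    "\<And>z v. z \<in> ball x r \<Longrightarrow>
       norm (frechet_derivative h (at z) v - frechet_derivative h (at x) v) \<le> e * norm v"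
proof -
  obtain T h' where T: "open T" "x \<in> T" "\<And>z. z \<in> T \<Longrightarrow> (h has_derivative h' z) (at z)"
    "\<And>v. continuous_on T (\<lambda>z. h' z v)"
    using C1_atE[OF assms(1)] by blast
  have h': "h' z = frechet_derivative h (at z)" if "z \<in> T" for z
    using T(3)[OF that] frechet_derivative_at by blast
  \<comment> \<open>the errors on the basis vectors add up to \<open>e\<close>\<close>
  define d where "d = e / DIM('a)"
  have d: "d > 0" using assms(2) by (simp add: d_def)
  have "\<forall>\<^sub>F z in nhds x. norm (h' z b - h' x b) < d" if "b \<in> Basis" for b
  proof -
    have "isCont (\<lambda>z. h' z b) x"
      using T(1,2,4) continuous_on_eq_continuous_at by blast
    then have "((\<lambda>z. h' z b) \<longlongrightarrow> h' x b) (nhds x)"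
      using tendsto_at_iff_tendsto_nhds[of "\<lambda>z. h' z b" x] by (simp add: isCont_def)
    then show ?thesis using d by (auto simp: tendsto_iff dist_norm)
  qed
  then have "\<forall>\<^sub>F z in nhds x. \<forall>b\<in>Basis. norm (h' z b - h' x b) < d"
    by (simp add: eventually_ball_finite)
  moreover have "\<forall>\<^sub>F z in nhds x. z \<in> T" using T by (simp add: eventually_nhds_in_open)
  ultimately have "\<forall>\<^sub>F z in nhds x. z \<in> T \<and> (\<forall>b\<in>Basis. norm (h' z b - h' x b) < d)"
    by eventually_elim auto
  then obtain r where r: "r > 0"
    "\<And>z. z \<in> ball x r \<Longrightarrow> z \<in> T \<and> (\<forall>b\<in>Basis. norm (h' z b - h' x b) < d)"
    unfolding eventually_nhds_metric by (metis dist_commute mem_ball)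
  show thesis
  proof (rule that[OF r(1)])
    show "C1_at h z" if "z \<in> ball x r" for z
      using C1_atI[OF T(1) _ T(3,4)] r(2)[OF that] by blast
    show "norm (frechet_derivative h (at z) v - frechet_derivative h (at x) v) \<le> e * norm v"
      if z: "z \<in> ball x r" for z v
    proof -
      have zT: "z \<in> T" using r(2)[OF z] by blast
      have lin: "linear (\<lambda>v. h' z v - h' x v)"
        using T(3)[OF zT] T(3)[OF T(2)]
        by (intro linear_compose_sub has_derivative_linear)
      have "h' z v - h' x v = (\<Sum>b\<in>Basis. (v \<bullet> b) *\<^sub>R (h' z b - h' x b))"
        using linear_sum[OF lin, of "\<lambda>b. (v \<bullet> b) *\<^sub>R b" Basis] linear_cmul[OF lin]
        by (simp add: euclidean_representation)
      also have "norm \<dots> \<le> (\<Sum>b\<in>(Basis::'a set). norm v * d)"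
      proof (rule sum_norm_le)
        fix b :: 'a assume b: "b \<in> Basis"
        show "norm ((v \<bullet> b) *\<^sub>R (h' z b - h' x b)) \<le> norm v * d"
          using r(2)[OF z] b by (auto intro!: mult_mono simp: Basis_le_norm less_imp_le)
      qed
      also have "\<dots> = e * norm v" by (simp add: d_def)
      finally show ?thesis using h'[OF zT] h'[OF T(2)] by simp
    qed
  qed
qed

text \<open>The mean value inequality applied to \<open>h\<close> minus its derivative at \<open>x\<close>. The
  linearisation error is small relative to the distance of any two points near \<open>x\<close>; later one of them
  runs over a submanifold, so a comparison with the base point alone would not suffice.\<close>

lemma C1_at_strict_derivative:
  assumes "C1_at h x" "e > 0"
  obtains r where "r > 0"
    "\<And>y z. y \<in> ball x r \<Longrightarrow> z \<in> ball x r \<Longrightarrow>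
       norm (h z - h y - frechet_derivative h (at x) (z - y)) \<le> e * norm (z - y)"
proof -
  obtain r where r: "r > 0" "\<And>z. z \<in> ball x r \<Longrightarrow> C1_at h z"
    "\<And>z v. z \<in> ball x r \<Longrightarrow>
       norm (frechet_derivative h (at z) v - frechet_derivative h (at x) v) \<le> e * norm v"
    using C1_at_derivative_close[OF assms] by blast
  let ?D = "frechet_derivative h (at x)"
  have lin: "linear ?D" using C1_at_has_derivative[OF assms(1)] has_derivative_linear by blast
  show thesis
  proof (rule that[OF r(1)])
    fix y z assume yz: "y \<in> ball x r" "z \<in> ball x r"
    have "norm ((h z - ?D z) - (h y - ?D y)) \<le> e * norm (z - y)"
    proof (rule differentiable_bound[OF convex_ball _ _ yz(2,1)])
      fix u assume u: "u \<in> ball x r"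
      show "((\<lambda>z. h z - ?D z) has_derivative (\<lambda>v. frechet_derivative h (at u) v - ?D v))
              (at u within ball x r)"
        using C1_at_has_derivative[OF r(2)[OF u]] C1_at_has_derivative[OF assms(1)]
        by (intro has_derivative_diff bounded_linear_imp_has_derivative)
          (auto intro: has_derivative_at_withinI has_derivative_bounded_linear)
      show "onorm (\<lambda>v. frechet_derivative h (at u) v - ?D v) \<le> e"
        using r(3)[OF u] assms(2) by (intro onorm_bound) auto
    qed
    then show "norm (h z - h y - ?D (z - y)) \<le> e * norm (z - y)"
      by (simp add: linear_diff[OF lin] algebra_simps)
  qed
qed

section \<open>Charts and local representatives\<close>

lemma chart_inv_left:
  assumes "is_chart c" "p \<in> fst c"
  shows "chart_inv c (snd c p) = p"
  using assms unfolding is_chart_def chart_inv_def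
  by (metis homeomorphism_apply1 inj_on_inverseI inv_into_f_f)

lemma chart_inv_right: "z \<in> snd c ` fst c \<Longrightarrow> snd c (chart_inv c z) = z"
  by (simp add: chart_inv_def f_inv_into_f)

lemma chart_inv_in: "z \<in> snd c ` fst c \<Longrightarrow> chart_inv c z \<in> fst c"
  by (simp add: chart_inv_def inv_into_into)

lemma chart_open: "is_chart c \<Longrightarrow> open (fst c)" "is_chart c \<Longrightarrow> open (snd c ` fst c)"
  by (auto simp: is_chart_def)

lemma chart_continuous: "is_chart c \<Longrightarrow> continuous_on (fst c) (snd c)"
  by (auto simp: is_chart_def homeomorphism_def)

lemma chart_inv_continuous:
  assumes "is_chart c"
  shows "continuous_on (snd c ` fst c) (chart_inv c)"
proof -
  obtain h where h: "homeomorphism (fst c) (snd c ` fst c) (snd c) h"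
    using assms unfolding is_chart_def by blast
  have "continuous_on (snd c ` fst c) h" using h by (simp add: homeomorphism_def)
  moreover have "h z = chart_inv c z" if "z \<in> snd c ` fst c" for z
    using that h chart_inv_left[OF assms] by (auto simp: homeomorphism_apply1)
  ultimately show ?thesis by (simp cong: continuous_on_cong)
qed

lemma chart_image_eq:
  assumes "is_chart c" "U \<subseteq> fst c"
  shows "snd c ` U = snd c ` fst c \<inter> chart_inv c -` U"
  using assms chart_inv_left[OF assms(1)] by (auto simp: image_iff subset_iff)

lemma open_chart_image:
  assumes "is_chart c" "open U" "U \<subseteq> fst c"
  shows "open (snd c ` U)"
  unfolding chart_image_eq[OF assms(1,3)]
  using chart_inv_continuous chart_open assms continuous_open_preimage by blast

lemma open_chart_preimage:
  assumes "is_chart c" "open V"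
  shows "open (fst c \<inter> snd c -` V)"
  using assms chart_continuous chart_open continuous_open_preimage by blast

lemma local_rep_at: "is_chart a \<Longrightarrow> p \<in> fst a \<Longrightarrow> local_rep a b F (snd a p) = snd b (F p)"
  by (simp add: local_rep_def chart_inv_left)

lemma local_rep_compose_near:
  assumes a: "is_chart a" and b: "is_chart b" and F: "continuous_on UNIV F"
    and p: "p \<in> fst a" "F p \<in> fst b"
  obtains T where "open T" "snd a p \<in> T"
    "\<And>z. z \<in> T \<Longrightarrow> (local_rep b c G \<circ> local_rep a b F) z = local_rep a c (G \<circ> F) z"
proof -
  let ?O = "fst a \<inter> F -` fst b"
  have "open (F -` fst b)"
    using F b chart_open(1) open_vimage by blast
  then have O: "open ?O" using chart_open(1)[OF a] by blast
  show thesis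
  proof (rule that[of "snd a ` ?O"])
    show "open (snd a ` ?O)" using open_chart_image[OF a O] by blast
    show "snd a p \<in> snd a ` ?O" using p by blast
    show "(local_rep b c G \<circ> local_rep a b F) z = local_rep a c (G \<circ> F) z"
      if "z \<in> snd a ` ?O" for z
      using that a b by (auto simp: local_rep_def chart_inv_left)
  qed
qed

lemma C1_at_local_rep_compose:
  fixes a b :: "('m::topological_space, 'e::euclidean_space) chart"
  assumes a: "is_chart a" and b: "is_chart b" and F: "continuous_on UNIV F"
    and p: "p \<in> fst a" "F p \<in> fst b"
    and "C1_at (local_rep a b F) (snd a p)" "C1_at (local_rep b c G) (snd b (F p))"
  shows "C1_at (local_rep a c (G \<circ> F)) (snd a p)"
proof -
  obtain T where T: "open T" "snd a p \<in> T"
    "\<And>z. z \<in> T \<Longrightarrow> (local_rep b c G \<circ> local_rep a b F) z = local_rep a c (G \<circ> F) z"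
    using local_rep_compose_near[OF a b F p] by blast
  have "C1_at (local_rep b c G \<circ> local_rep a b F) (snd a p)"
    using assms by (intro C1_at_compose) (auto simp: local_rep_at)
  then show ?thesis using T by (rule C1_at_cong)
qed

text \<open>Regularity is required in all C^1 charts and not only in those of the atlas, because the
  slice charts of a submanifold are in general not in the atlas.\<close>

definition C1_in_charts ::
  "('m::topological_space, 'e::euclidean_space) chart set \<Rightarrow> ('m \<Rightarrow> 'm) \<Rightarrow> bool" where
  "C1_in_charts A F \<longleftrightarrow> continuous_on UNIV F \<and>
     (\<forall>a b p. C1_chart A a \<and> C1_chart A b \<and> p \<in> fst a \<and> F p \<in> fst b \<longrightarrow>
        C1_at (local_rep a b F) (snd a p))"

lemma C1_in_chartsD:
  assumes "C1_in_charts A F" "C1_chart A a" "C1_chart A b" "p \<in> fst a" "F p \<in> fst b"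
  shows "C1_at (local_rep a b F) (snd a p)"
  using assms unfolding C1_in_charts_def by blast

lemma C1_in_charts_continuous: "C1_in_charts A F \<Longrightarrow> continuous_on UNIV F"
  by (simp add: C1_in_charts_def)

lemma smooth_on_imp_C1: "smooth_on h T \<Longrightarrow> Ck_on 1 h T"
  unfolding smooth_on_def by blast

lemma C1_chart_is_chart: "C1_chart A c \<Longrightarrow> is_chart c"
  by (simp add: C1_chart_def)

lemma atlas_C1_chart:
  assumes "smooth_atlas A" "c \<in> A"
  shows "C1_chart A c"
  using assms unfolding smooth_atlas_def C1_chart_def
  by (metis Int_commute smooth_on_imp_C1)

lemma chart_at_in:
  assumes "smooth_atlas A"
  shows "chart_at A p \<in> A" "p \<in> fst (chart_at A p)"
proof -
  have "\<exists>c. c \<in> A \<and> p \<in> fst c" using assms unfolding smooth_atlas_def by blast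
  then have "chart_at A p \<in> A \<and> p \<in> fst (chart_at A p)"
    unfolding chart_at_def by (rule someI_ex)
  then show "chart_at A p \<in> A" "p \<in> fst (chart_at A p)" by auto
qed

lemma chart_at_C1:
  assumes "smooth_atlas A" shows "C1_chart A (chart_at A p)"
  using assms atlas_C1_chart chart_at_in by blast

lemma C1_at_transition:
  assumes A: "smooth_atlas A" and c: "C1_chart A c" "c' \<in> A" "p \<in> fst c" "p \<in> fst c'"
  shows "C1_at (local_rep c c' id) (snd c p)" "C1_at (local_rep c' c id) (snd c' p)"
proof -
  have ch: "is_chart c" "is_chart c'"
    using A c atlas_C1_chart C1_chart_is_chart by blast+
  have op: "open (fst c \<inter> fst c')" using ch chart_open by blast
  show "C1_at (local_rep c c' id) (snd c p)" "C1_at (local_rep c' c id) (snd c' p)"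
    unfolding C1_at_def
    using c open_chart_image[OF ch(1) op] open_chart_image[OF ch(2) op]
    by (auto simp: C1_chart_def)
qed

text \<open>Factor through the charts selected at \<open>p\<close> and at its image; the changes of charts are C^1.\<close>

lemma C1_map_in_charts:
  assumes A: "smooth_atlas A" and F: "C1_map A F"
  shows "C1_in_charts A F"
  unfolding C1_in_charts_def
proof (intro conjI allI impI)
  show cF: "continuous_on UNIV F" using F by (simp add: C1_map_def)
  fix a b p assume "C1_chart A a \<and> C1_chart A b \<and> p \<in> fst a \<and> F p \<in> fst b"
  then have a: "C1_chart A a" and b: "C1_chart A b" and p: "p \<in> fst a" "F p \<in> fst b" by auto
  let ?a = "chart_at A p" and ?b = "chart_at A (F p)"
  note in_a = chart_at_in[OF A, of p] and in_b = chart_at_in[OF A, of "F p"]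
  have ch: "is_chart a" "is_chart b" "is_chart ?a" "is_chart ?b"
    using a b chart_at_C1[OF A] C1_chart_is_chart by blast+
  have 1: "C1_at (local_rep a ?a id) (snd a p)"
    using C1_at_transition(1)[OF A a in_a(1) p(1) in_a(2)] .
  have "open (F -` fst ?b)" using cF ch(4) chart_open(1) open_vimage by blast
  then have "open (snd ?a ` (fst ?a \<inter> F -` fst ?b))"
    using open_chart_image[OF ch(3)] chart_open(1)[OF ch(3)] by blast
  moreover have "Ck_on 1 (local_rep ?a ?b F) (snd ?a ` (fst ?a \<inter> F -` fst ?b))"
    using F in_a in_b unfolding C1_map_def by blast
  ultimately have 2: "C1_at (local_rep ?a ?b F) (snd ?a p)"
    unfolding C1_at_def using in_a(2) in_b(2) by blast
  have 3: "C1_at (local_rep ?b b id) (snd ?b (F p))"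
    using C1_at_transition(2)[OF A b in_b(1) p(2) in_b(2)] .
  have "C1_at (local_rep a ?b (F \<circ> id)) (snd a p)"
    using 1 2 in_a p ch in_b by (intro C1_at_local_rep_compose[of a ?a]) auto
  then have "C1_at (local_rep a ?b F) (snd a p)" by simp
  then have "C1_at (local_rep a b (id \<circ> F)) (snd a p)"
    using 3 in_b p ch cF by (intro C1_at_local_rep_compose[of a ?b]) auto
  then show "C1_at (local_rep a b F) (snd a p)" by simp
qed

lemma C1_in_charts_compose:
  assumes A: "smooth_atlas A" and F: "C1_in_charts A F" and G: "C1_in_charts A G"
  shows "C1_in_charts A (G \<circ> F)"
  unfolding C1_in_charts_def
proof (intro conjI allI impI)
  show "continuous_on UNIV (G \<circ> F)"
    using F G by (meson C1_in_charts_continuous continuous_on_compose continuous_on_subset subset_UNIV)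
  fix a b p assume "C1_chart A a \<and> C1_chart A b \<and> p \<in> fst a \<and> (G \<circ> F) p \<in> fst b"
  then have a: "C1_chart A a" and b: "C1_chart A b" and p: "p \<in> fst a" "G (F p) \<in> fst b" by auto
  let ?b = "chart_at A (F p)"
  show "C1_at (local_rep a b (G \<circ> F)) (snd a p)"
    using a b p chart_at_in[OF A] chart_at_C1[OF A] C1_chart_is_chart
      C1_in_chartsD[OF F a, of ?b p] C1_in_chartsD[OF G _ b, of ?b "F p"]
      C1_in_charts_continuous[OF F]
    by (intro C1_at_local_rep_compose[of a ?b]) blast+
qed

lemma C1_in_charts_id:
  assumes A: "smooth_atlas A"
  shows "C1_in_charts A id"
proof (rule C1_map_in_charts[OF A])
  show "C1_map A id"
    using A atlas_C1_chart[OF A] by (auto simp: C1_map_def C1_chart_def)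
qed

lemma C1_in_charts_funpow:
  assumes A: "smooth_atlas A" and F: "C1_in_charts A F"
  shows "C1_in_charts A (F ^^ n)"
proof (induction n)
  case 0
  show ?case using C1_in_charts_id[OF A] by (simp add: id_def)
next
  case (Suc n)
  show ?case using C1_in_charts_compose[OF A Suc F] by (simp only: funpow.simps)
qed

section \<open>Derivatives read in charts\<close>

text \<open>This notion contains the tangent map (both charts selected by \<open>chart_at\<close>) and, for the identity
  map, the passage between components of a vector in two charts. The chain rule and the inverse rule
  below then cover all of them at once.\<close>

definition mderiv ::
  "('m, 'e::euclidean_space) chart \<Rightarrow> ('m, 'e) chart \<Rightarrow> ('m \<Rightarrow> 'm) \<Rightarrow> 'm \<Rightarrow> 'e \<Rightarrow> 'e" where
  "mderiv a b F p = frechet_derivative (local_rep a b F) (at (snd a p))"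

lemma tangent_map_mderiv: "tangent_map A F p = mderiv (chart_at A p) (chart_at A (F p)) F p"
  by (simp add: tangent_map_def mderiv_def)

lemma chart_deriv_mderiv: "chart_deriv A c p = mderiv (chart_at A p) c id p"
  by (simp add: chart_deriv_def mderiv_def)

lemma chart_vector_mderiv: "chart_vector A c p = mderiv c (chart_at A p) id p"
  by (simp add: chart_vector_def mderiv_def)

lemma mderiv_has_derivative:
  assumes "C1_in_charts A F" "C1_chart A a" "C1_chart A b" "p \<in> fst a" "F p \<in> fst b"
  shows "(local_rep a b F has_derivative mderiv a b F p) (at (snd a p))"
  unfolding mderiv_def by (rule C1_at_has_derivative[OF C1_in_chartsD[OF assms]])

lemma mderiv_linear:
  assumes "C1_in_charts A F" "C1_chart A a" "C1_chart A b" "p \<in> fst a" "F p \<in> fst b"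
  shows "linear (mderiv a b F p)"
  using mderiv_has_derivative[OF assms] has_derivative_linear by blast

lemma mderiv_chain:
  assumes F: "C1_in_charts A F" and G: "C1_in_charts A G"
    and c: "C1_chart A a" "C1_chart A b" "C1_chart A c"
    and p: "p \<in> fst a" "F p \<in> fst b" "G (F p) \<in> fst c"
  shows "mderiv a c (G \<circ> F) p v = mderiv b c G (F p) (mderiv a b F p v)"
proof -
  have ch: "is_chart a" "is_chart b" using c C1_chart_is_chart by blast+
  obtain T where T: "open T" "snd a p \<in> T"
    "\<And>z. z \<in> T \<Longrightarrow> (local_rep b c G \<circ> local_rep a b F) z = local_rep a c (G \<circ> F) z"
    using local_rep_compose_near[OF ch C1_in_charts_continuous[OF F] p(1,2)] by blast
  have "(local_rep b c G \<circ> local_rep a b F has_derivative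
      mderiv b c G (F p) \<circ> mderiv a b F p) (at (snd a p))"
    using mderiv_has_derivative[OF F c(1,2) p(1,2)] mderiv_has_derivative[OF G c(2,3) p(2,3)]
    by (intro diff_chain_at) (simp_all add: local_rep_at[OF ch(1) p(1)])
  then have "(local_rep a c (G \<circ> F) has_derivative mderiv b c G (F p) \<circ> mderiv a b F p)
      (at (snd a p))"
    using T by (rule has_derivative_transform_within_open)
  then have "mderiv b c G (F p) \<circ> mderiv a b F p = mderiv a c (G \<circ> F) p"
    unfolding mderiv_def[of a c] by (rule frechet_derivative_at)
  then show ?thesis by (metis comp_apply)
qed

lemma mderiv_id:
  assumes "is_chart a" "p \<in> fst a"
  shows "mderiv a a id p v = v"
proof -
  have "(local_rep a a id has_derivative id) (at (snd a p))"
  proof (rule has_derivative_transform_within_open)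
    show "(id has_derivative id) (at (snd a p))" by simp
    show "open (snd a ` fst a)" using chart_open(2)[OF assms(1)] .
    show "snd a p \<in> snd a ` fst a" using assms by blast
    show "id z = local_rep a a id z" if "z \<in> snd a ` fst a" for z
      using that by (simp add: local_rep_def chart_inv_right)
  qed
  then have "id = mderiv a a id p" unfolding mderiv_def by (rule frechet_derivative_at)
  then show ?thesis by (metis id_apply)
qed

lemma mderiv_inverse:
  assumes F: "C1_in_charts A F" and G: "C1_in_charts A G" and GF: "G \<circ> F = id"
    and c: "C1_chart A a" "C1_chart A b" and p: "p \<in> fst a" "F p \<in> fst b"
  shows "mderiv b a G (F p) (mderiv a b F p v) = v"
proof -
  have "G (F p) = p" using GF by (metis comp_apply id_apply)
  then show ?thesis
    using mderiv_chain[OF F G c c(1) p, of v] mderiv_id[OF C1_chart_is_chart[OF c(1)] p(1)] GF p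
    by simp
qed

lemma mderiv_locally_bounded:
  assumes F: "C1_in_charts A F" and c: "C1_chart A a" "C1_chart A b"
    and p: "p \<in> fst a" "F p \<in> fst b"
  obtains U B where "open U" "p \<in> U" "U \<subseteq> fst a" "F ` U \<subseteq> fst b" "B > 0"
    "\<And>q v. q \<in> U \<Longrightarrow> norm (mderiv a b F q v) \<le> B * norm v"
proof -
  have ch: "is_chart a" "is_chart b" using c C1_chart_is_chart by blast+
  obtain r where r: "r > 0"
    "\<And>z v. z \<in> ball (snd a p) r \<Longrightarrow> norm (frechet_derivative (local_rep a b F) (at z) v -
        mderiv a b F p v) \<le> 1 * norm v"
    using C1_at_derivative_close[OF C1_in_chartsD[OF F c p], of 1] unfolding mderiv_def
    by (metis zero_less_one)
  let ?D = "mderiv a b F p"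
  have bl: "bounded_linear ?D"
    using mderiv_has_derivative[OF F c p] has_derivative_bounded_linear by blast
  define U where "U = (fst a \<inter> snd a -` ball (snd a p) r) \<inter> F -` fst b"
  have oF: "open (F -` fst b)"
    using C1_in_charts_continuous[OF F] chart_open(1)[OF ch(2)] open_vimage by blast
  show thesis
  proof (rule that[of U "onorm ?D + 1"])
    show "open U" unfolding U_def using open_chart_preimage[OF ch(1)] oF by blast
    show "onorm ?D + 1 > 0" using onorm_pos_le[OF bl] by simp
    show "norm (mderiv a b F q v) \<le> (onorm ?D + 1) * norm v" if "q \<in> U" for q v
    proof -
      have "norm (mderiv a b F q v - ?D v) \<le> norm v"
        using that r(2)[of "snd a q" v] by (simp add: U_def mderiv_def)
      moreover have "norm (?D v) \<le> onorm ?D * norm v" using onorm[OF bl] .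
      ultimately show ?thesis
        using norm_triangle_sub[of "mderiv a b F q v" "?D v"] by (simp add: algebra_simps)
    qed
  qed (use p r(1) in \<open>auto simp: U_def\<close>)
qed

section \<open>Norms of tangent vectors\<close>

lemma riemannian_metricD:
  assumes "riemannian_metric A g"
  shows "bilinear (g p)" "g p u v = g p v u" "v \<noteq> 0 \<Longrightarrow> g p v v > 0"
  using assms unfolding riemannian_metric_def by blast+

lemma metric_nonneg:
  assumes "riemannian_metric A g"
  shows "g p v v \<ge> 0"
  using riemannian_metricD[OF assms] bilinear_lzero[of "g p"] by (cases "v = 0") (auto simp: less_imp_le)

lemma metric_norm_nonneg: "riemannian_metric A g \<Longrightarrow> metric_norm g p v \<ge> 0"
  by (simp add: metric_norm_def metric_nonneg)

lemma metric_norm_pos: "riemannian_metric A g \<Longrightarrow> v \<noteq> 0 \<Longrightarrow> metric_norm g p v > 0"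
  by (simp add: metric_norm_def riemannian_metricD)

lemma metric_norm_zero: "riemannian_metric A g \<Longrightarrow> metric_norm g p 0 = 0"
  using riemannian_metricD(1)[of A g p] by (simp add: metric_norm_def bilinear_lzero)

lemma metric_norm_scale:
  assumes "riemannian_metric A g"
  shows "metric_norm g p (r *\<^sub>R v) = \<bar>r\<bar> * metric_norm g p v"
proof -
  have "g p (r *\<^sub>R v) (r *\<^sub>R v) = r\<^sup>2 * g p v v"
    using riemannian_metricD(1)[OF assms, of p]
    by (simp add: bilinear_lmul bilinear_rmul power2_eq_square)
  then show ?thesis by (simp add: metric_norm_def real_sqrt_mult)
qed

text \<open>Positivity of the metric on \<open>g v v *\<^sub>R u - g u v *\<^sub>R v\<close>.\<close>

lemma metric_Cauchy_Schwarz: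
  assumes "riemannian_metric A g"
  shows "(g p u v)\<^sup>2 \<le> g p u u * g p v v"
proof (cases "v = 0")
  case True
  then show ?thesis
    using riemannian_metricD(1)[OF assms, of p] by (simp add: bilinear_rzero)
next
  case False
  note bil = riemannian_metricD(1)[OF assms, of p]
  let ?w = "g p v v *\<^sub>R u - g p u v *\<^sub>R v"
  have "0 \<le> g p ?w ?w" by (rule metric_nonneg[OF assms])
  also have "g p ?w ?w = g p v v * (g p u u * g p v v - (g p u v)\<^sup>2)"
    using riemannian_metricD(2)[OF assms, of p v u]
    by (simp add: bilinear_lsub[OF bil] bilinear_rsub[OF bil] bilinear_lmul[OF bil]
        bilinear_rmul[OF bil] power2_eq_square algebra_simps)
  finally show ?thesis
    using riemannian_metricD(3)[OF assms False, of p] by (simp add: zero_le_mult_iff)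
qed

lemma metric_norm_triangle:
  assumes "riemannian_metric A g"
  shows "metric_norm g p (u + v) \<le> metric_norm g p u + metric_norm g p v"
proof -
  note bil = riemannian_metricD(1)[OF assms, of p]
  note nn = metric_nonneg[OF assms, of p]
  have "g p u v \<le> sqrt (g p u u * g p v v)"
    using metric_Cauchy_Schwarz[OF assms] real_le_rsqrt by blast
  then have "g p (u + v) (u + v) \<le> (metric_norm g p u + metric_norm g p v)\<^sup>2"
    using riemannian_metricD(2)[OF assms, of p v u] nn
    by (simp add: metric_norm_def power2_sum bilinear_ladd[OF bil] bilinear_radd[OF bil]
        real_sqrt_mult)
  then show ?thesis
    unfolding metric_norm_def[of g p "u + v"]
    by (simp add: metric_norm_nonneg[OF assms] real_le_lsqrt)
qed

text \<open>The components of a tangent vector refer to a chart that jumps from point to point, so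
  \<open>metric_norm\<close> is not continuous in the base point as it stands. In one fixed chart of the atlas
  the metric is a continuous family of positive definite quadratic forms, which is bounded above and away
  from zero on a compact ball times the unit sphere. Passing to the chart \<open>c\<close> costs a bounded factor.\<close>

lemma metric_chart_comparison:
  assumes A: "smooth_atlas A" and g: "riemannian_metric A g"
    and c: "C1_chart A c" and x: "x \<in> fst c"
  obtains U M where "open U" "x \<in> U" "U \<subseteq> fst c" "M \<ge> 1"
    "\<And>q v. q \<in> U \<Longrightarrow> norm (chart_deriv A c q v) \<le> M * metric_norm g q v"
    "\<And>q v. q \<in> U \<Longrightarrow> metric_norm g q v \<le> M * norm (chart_deriv A c q v)"
proof -
  define a where "a = chart_at A x"
  have aA: "a \<in> A" and xa: "x \<in> fst a" using chart_at_in[OF A] by (auto simp: a_def)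
  have a: "C1_chart A a" using chart_at_C1[OF A] by (simp add: a_def)
  have ch: "is_chart a" using a C1_chart_is_chart by blast
  note I = C1_in_charts_id[OF A]
  define L where "L z = chart_vector A a (chart_inv a z)" for z
  define G where "G z u v = g (chart_inv a z) (L z u) (L z v)" for z u v
  define D where "D = snd a ` fst a"
  have inD: "chart_inv a z \<in> fst a" if "z \<in> D" for z
    using chart_inv_in[of z a] that by (simp add: D_def)
  have linL: "linear (L z)" if "z \<in> D" for z
    unfolding L_def chart_vector_mderiv
    using inD[OF that] chart_at_in[OF A] chart_at_C1[OF A]
    by (intro mderiv_linear[OF I a]) auto
  have L0: "L z v = 0 \<Longrightarrow> v = 0" if "z \<in> D" for z v
    using mderiv_inverse[OF I I _ a chart_at_C1[OF A] inD[OF that], of "chart_inv a z" v]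
      mderiv_linear[OF I chart_at_C1[OF A] a, of "chart_inv a z"] linear_0
      chart_at_in[OF A] inD[OF that]
    by (auto simp: L_def chart_vector_mderiv)
  have linG: "linear (\<lambda>u. G z u v)" "linear (G z v)" if "z \<in> D" for z v
  proof -
    have b: "linear (g (chart_inv a z) w)" "linear (\<lambda>u. g (chart_inv a z) u w)" for w
      using riemannian_metricD(1)[OF g] by (auto simp: bilinear_def)
    show "linear (\<lambda>u. G z u v)"
      using linear_compose[OF linL[OF that] b(2)] by (simp add: G_def o_def)
    show "linear (G z v)"
      using linear_compose[OF linL[OF that] b(1)] by (simp add: G_def[abs_def] o_def)
  qed
  have contG: "continuous_on D (\<lambda>z. G z u v)" for u v
  proof -
    have "smooth_on (\<lambda>z. G z u v) D"
      using g aA unfolding riemannian_metric_def G_def L_def D_def by blast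
    then have "Ck_on 0 (\<lambda>z. G z u v) D" unfolding smooth_on_def by blast
    then show ?thesis by simp
  qed
  have fst_cont: "continuous_on (D \<times> UNIV) (\<lambda>y. G (fst y) u v)" for u v
    by (rule continuous_on_compose2[OF contG]) (auto intro: continuous_intros)
  have snd_cont: "continuous_on (D \<times> UNIV) (\<lambda>y. G (fst y) u (snd y))" for u
    by (rule continuous_on_linear_family[where L = "\<lambda>y. G (fst y) u" and w = snd])
      (use fst_cont linG(2) in \<open>auto intro: continuous_on_snd\<close>)
  \<comment> \<open>bilinearity gives joint continuity, one argument at a time\<close>
  have contQ: "continuous_on (D \<times> UNIV) (\<lambda>y. G (fst y) (snd y) (snd y))"
    by (rule continuous_on_linear_family[where L = "\<lambda>y v. G (fst y) v (snd y)" and w = snd])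
      (use snd_cont linG(1) in \<open>auto intro: continuous_on_snd\<close>)
  have "open D" "snd a x \<in> D" using chart_open(2)[OF ch] xa by (auto simp: D_def)
  then obtain r where r: "r > 0" "cball (snd a x) r \<subseteq> D"
    using open_contains_cball by blast
  let ?K = "cball (snd a x) r \<times> sphere (0::'b) 1"
  have K: "compact ?K" "?K \<noteq> {}"
    using r(1) by (auto simp: compact_Times)
  have contK: "continuous_on ?K (\<lambda>y. G (fst y) (snd y) (snd y))"
    using contQ by (rule continuous_on_subset) (use r(2) in auto)
  obtain y0 where y0: "y0 \<in> ?K" "\<And>y. y \<in> ?K \<Longrightarrow> G (fst y0) (snd y0) (snd y0) \<le> G (fst y) (snd y) (snd y)"
    using continuous_attains_inf[OF K contK] by blast
  obtain y1 where y1: "y1 \<in> ?K" "\<And>y. y \<in> ?K \<Longrightarrow> G (fst y) (snd y) (snd y) \<le> G (fst y1) (snd y1) (snd y1)"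
    using continuous_attains_sup[OF K contK] by blast
  define m where "m = sqrt (G (fst y0) (snd y0) (snd y0))"
  define m' where "m' = sqrt (G (fst y1) (snd y1) (snd y1))"
  have "fst y0 \<in> D" "snd y0 \<noteq> 0" using y0(1) r(2) by auto
  then have "G (fst y0) (snd y0) (snd y0) > 0"
    using L0 riemannian_metricD(3)[OF g] unfolding G_def by blast
  then have m: "m > 0" by (simp add: m_def)
  have unit: "m \<le> sqrt (G z u u)" "sqrt (G z u u) \<le> m'"
    if "z \<in> cball (snd a x) r" "norm u = 1" for z u
    using y0(2)[of "(z, u)"] y1(2)[of "(z, u)"] that by (auto simp: m_def m'_def)
  have comp: "m * norm u \<le> sqrt (G z u u)" "sqrt (G z u u) \<le> m' * norm u"
    if z: "z \<in> cball (snd a x) r" for z u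
  proof -
    have zD: "z \<in> D" using z r(2) by blast
    have "m * norm u \<le> sqrt (G z u u) \<and> sqrt (G z u u) \<le> m' * norm u"
    proof (cases "u = 0")
      case True
      then show ?thesis using linear_0[OF linG(1)[OF zD, of 0]] by simp
    next
      case False
      define e where "e = u /\<^sub>R norm u"
      have e: "norm e = 1" "u = norm u *\<^sub>R e" using False by (auto simp: e_def)
      have "sqrt (G z u u) = norm u * sqrt (G z e e)"
        unfolding G_def metric_norm_def[of g "chart_inv a z", symmetric]
        by (subst (1) e(2)) (simp add: linear_cmul[OF linL[OF zD]] metric_norm_scale[OF g])
      then show ?thesis
        using mult_left_mono[OF unit(1)[OF z e(1)], of "norm u"]
          mult_left_mono[OF unit(2)[OF z e(1)], of "norm u"] by (simp add: mult.commute)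
    qed
    then show "m * norm u \<le> sqrt (G z u u)" "sqrt (G z u u) \<le> m' * norm u" by auto
  qed
  have m': "m' \<ge> 0" using y1(1) unfolding m'_def G_def by (simp add: metric_nonneg[OF g])
  obtain U1 B1 where U1: "open U1" "x \<in> U1" "U1 \<subseteq> fst a" "id ` U1 \<subseteq> fst c" "B1 > 0"
    "\<And>q v. q \<in> U1 \<Longrightarrow> norm (mderiv a c id q v) \<le> B1 * norm v"
    using mderiv_locally_bounded[OF I a c xa] x by auto
  obtain U2 B2 where U2: "open U2" "x \<in> U2" "U2 \<subseteq> fst c" "id ` U2 \<subseteq> fst a" "B2 > 0"
    "\<And>q v. q \<in> U2 \<Longrightarrow> norm (mderiv c a id q v) \<le> B2 * norm v"
    using mderiv_locally_bounded[OF I c a x] xa by auto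
  define U where "U = U1 \<inter> U2 \<inter> (fst a \<inter> snd a -` ball (snd a x) r)"
  define M where "M = max 1 (max (B1 / m) (m' * B2))"
  have main: "norm (chart_deriv A c q v) \<le> M * metric_norm g q v \<and>
      metric_norm g q v \<le> M * norm (chart_deriv A c q v)" if q: "q \<in> U" for q v
  proof -
    have qa: "q \<in> fst a" and qc: "q \<in> fst c" and qr: "snd a q \<in> cball (snd a x) r"
      using q U1(3) U2(3) by (auto simp: U_def)
    have iq: "chart_inv a (snd a q) = q" using chart_inv_left[OF ch qa] .
    note cq = chart_at_C1[OF A, of q] chart_at_in(2)[OF A, of q]
    define u where "u = mderiv (chart_at A q) a id q v"
    have "L (snd a q) u = v"
      using mderiv_inverse[OF I I _ cq(1) a cq(2), of v] qa
      by (simp add: L_def iq chart_vector_mderiv u_def)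
    then have gv: "sqrt (G (snd a q) u u) = metric_norm g q v"
      by (simp add: G_def iq metric_norm_def)
    have 1: "chart_deriv A c q v = mderiv a c id q u"
      using mderiv_chain[OF I I cq(1) a c cq(2), of v] qa qc
      by (simp add: chart_deriv_mderiv u_def)
    have 2: "u = mderiv c a id q (chart_deriv A c q v)"
      using mderiv_chain[OF I I cq(1) c a cq(2), of v] qa qc
      by (simp add: chart_deriv_mderiv u_def)
    have "norm (chart_deriv A c q v) \<le> B1 * norm u"
      using U1(6)[of q u] q by (simp add: 1 U_def)
    also have "\<dots> \<le> B1 * (metric_norm g q v / m)"
      using comp(1)[OF qr, of u] m U1(5) by (simp add: gv field_simps)
    also have "\<dots> = B1 / m * metric_norm g q v" by simp
    also have "\<dots> \<le> M * metric_norm g q v"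
      by (intro mult_right_mono metric_norm_nonneg[OF g]) (simp add: M_def)
    finally have *: "norm (chart_deriv A c q v) \<le> M * metric_norm g q v" .
    have "metric_norm g q v \<le> m' * norm u"
      using comp(2)[OF qr, of u] by (simp add: gv)
    also have "\<dots> \<le> m' * (B2 * norm (chart_deriv A c q v))"
      using U2(6)[of q "chart_deriv A c q v"] q m'
      by (intro mult_left_mono) (auto simp: 2[symmetric] U_def)
    also have "\<dots> = m' * B2 * norm (chart_deriv A c q v)" by simp
    also have "\<dots> \<le> M * norm (chart_deriv A c q v)"
      by (intro mult_right_mono) (auto simp: M_def)
    finally show ?thesis using * by blast
  qed
  show thesis
  proof (rule that[of U M])
    show "open U" unfolding U_def using U1(1) U2(1) open_chart_preimage[OF ch open_ball] by blast
    show "x \<in> U" using U1(2) U2(2) xa r(1) by (simp add: U_def)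
    show "U \<subseteq> fst c" using U2(3) by (auto simp: U_def)
    show "M \<ge> 1" by (simp add: M_def)
  qed (use main in auto)
qed

section \<open>Tangent spaces in slice charts\<close>

text \<open>Difference quotients of \<open>h\<close> along \<open>v\<close> lie in the closed set \<open>W\<close>.\<close>

lemma derivative_in_subspace:
  fixes h :: "'a::real_normed_vector \<Rightarrow> 'b::euclidean_space"
  assumes h: "(h has_derivative D) (at z)" and T: "open T" "z \<in> T"
    and V: "subspace V" "z \<in> V" "v \<in> V" and W: "subspace W"
    and hVW: "\<And>y. y \<in> T \<Longrightarrow> y \<in> V \<Longrightarrow> h y \<in> W"
  shows "D v \<in> W"
proof -
  have "((\<lambda>t. z + t *\<^sub>R v) has_derivative (\<lambda>t. t *\<^sub>R v)) (at (0::real))"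
    by (auto intro!: derivative_eq_intros)
  moreover have "(h has_derivative D) (at (z + (0::real) *\<^sub>R v))" using h by simp
  ultimately have "(h \<circ> (\<lambda>t. z + t *\<^sub>R v) has_derivative D \<circ> (\<lambda>t. t *\<^sub>R v)) (at (0::real))"
    by (rule diff_chain_at)
  moreover have "D \<circ> (\<lambda>t. t *\<^sub>R v) = (\<lambda>t. t *\<^sub>R D v)"
    using has_derivative_linear[OF h] by (auto simp: linear_cmul)
  ultimately have "((\<lambda>t. h (z + t *\<^sub>R v)) has_derivative (\<lambda>t. t *\<^sub>R D v)) (at 0)"
    by (simp add: o_def)
  then have lim0: "((\<lambda>t. norm (h (z + t *\<^sub>R v) - h z - t *\<^sub>R D v) / norm t) \<longlongrightarrow> 0) (at 0)"
    by (simp add: has_derivative_at)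
  have "norm (x - t *\<^sub>R y) / norm t = norm (x /\<^sub>R t - y)" if "t \<noteq> 0" for t :: real and x y :: 'b
  proof -
    have "x /\<^sub>R t - y = (x - t *\<^sub>R y) /\<^sub>R t" using that by (simp add: scaleR_diff_right)
    then show ?thesis by (simp add: divide_inverse mult.commute)
  qed
  then have "\<forall>\<^sub>F t in at 0. norm (h (z + t *\<^sub>R v) - h z - t *\<^sub>R D v) / norm t =
      norm ((h (z + t *\<^sub>R v) - h z) /\<^sub>R t - D v)"
    by (auto simp: eventually_at_filter)
  then have "((\<lambda>t. norm ((h (z + t *\<^sub>R v) - h z) /\<^sub>R t - D v)) \<longlongrightarrow> 0) (at 0)"
    by (rule Lim_transform_eventually[OF lim0])
  then have lim: "((\<lambda>t. (h (z + t *\<^sub>R v) - h z) /\<^sub>R t) \<longlongrightarrow> D v) (at 0)"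
    by (rule LIM_zero_cancel[OF tendsto_norm_zero_cancel])
  have "((\<lambda>t::real. z + t *\<^sub>R v) \<longlongrightarrow> z + 0 *\<^sub>R v) (at 0)" by (intro tendsto_intros)
  then have "\<forall>\<^sub>F t in at (0::real). z + t *\<^sub>R v \<in> T"
    using topological_tendstoD[OF _ T(1)] T(2) by simp
  then have "\<forall>\<^sub>F t in at (0::real). (h (z + t *\<^sub>R v) - h z) /\<^sub>R t \<in> W"
  proof eventually_elim
    case (elim t)
    then show ?case
      using V W hVW[OF elim] hVW[OF T(2)]
      by (simp add: subspace_add subspace_diff subspace_scale)
  qed
  then show ?thesis
    using Lim_in_closed_set[OF closed_subspace[OF W] _ _ lim] by simp
qed

lemma slice_chart_iff:
  assumes "slice_chart A d S c V w" "q \<in> fst c"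
  shows "q \<in> S \<longleftrightarrow> snd c q \<in> V \<and> snd c q \<bullet> w \<ge> 0"
proof
  have eq: "snd c ` (S \<inter> fst c) = {z \<in> V. z \<bullet> w \<ge> 0} \<inter> snd c ` fst c"
    using assms(1) by (simp add: slice_chart_def)
  show "q \<in> S \<Longrightarrow> snd c q \<in> V \<and> snd c q \<bullet> w \<ge> 0" using eq assms(2) by blast
  assume "snd c q \<in> V \<and> snd c q \<bullet> w \<ge> 0"
  then have "snd c q \<in> snd c ` (S \<inter> fst c)" using eq assms(2) by blast
  then obtain q' where "q' \<in> S" "q' \<in> fst c" "snd c q = snd c q'" by blast
  moreover have "is_chart c" using assms(1) by (simp add: slice_chart_def C1_chart_def)
  ultimately show "q \<in> S" by (metis assms(2) chart_inv_left)
qed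

text \<open>The transition map sends \<open>V\<close>, which is all of the submanifold near an interior point, into
  \<open>V'\<close>; so does its derivative, which is injective, and the dimensions agree.\<close>

lemma slice_transition:
  assumes A: "smooth_atlas A" and c: "slice_chart A d S c V 0"
    and c': "slice_chart A d S c' V' w" and p: "p \<in> S" "p \<in> fst c" "p \<in> fst c'"
  shows "mderiv c c' id p ` V = V'"
proof -
  note I = C1_in_charts_id[OF A]
  have C: "C1_chart A c" "C1_chart A c'" and V: "subspace V" "subspace V'" and d: "dim V = dim V'"
    using c c' by (auto simp: slice_chart_def)
  have ch: "is_chart c" "is_chart c'" using C C1_chart_is_chart by blast+
  let ?D = "mderiv c c' id p"
  have der: "(local_rep c c' id has_derivative ?D) (at (snd c p))"
    using mderiv_has_derivative[OF I C] p by simp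
  have lin: "linear ?D" using der has_derivative_linear by blast
  have "?D v \<in> V'" if "v \<in> V" for v
  proof (rule derivative_in_subspace[OF der _ _ V(1) _ that V(2)])
    show "open (snd c ` (fst c \<inter> fst c'))"
      using chart_open(1)[OF ch(1)] chart_open(1)[OF ch(2)]
      by (intro open_chart_image[OF ch(1)]) auto
    show "snd c p \<in> snd c ` (fst c \<inter> fst c')" using p by blast
    show "snd c p \<in> V" using slice_chart_iff[OF c p(2)] p(1) by blast
    fix y assume y: "y \<in> snd c ` (fst c \<inter> fst c')" "y \<in> V"
    then obtain q where q: "q \<in> fst c" "q \<in> fst c'" "y = snd c q" by blast
    have "q \<in> S" using slice_chart_iff[OF c q(1)] q(3) y(2) by simp
    then show "local_rep c c' id y \<in> V'"
      using slice_chart_iff[OF c' q(2)] q ch by (simp add: local_rep_at)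
  qed
  then have sub: "?D ` V \<subseteq> V'" by blast
  have "mderiv c' c id p (?D v) = v" for v
    using mderiv_inverse[OF I I _ C p(2), of v] p(3) by simp
  then have "inj ?D" by (rule inj_on_inverseI)
  then have "dim (?D ` V) = dim V'"
    using dim_image_eq[OF lin, of V] d by (simp add: inj_on_subset)
  then show ?thesis
    using subspace_dim_equal[OF linear_subspace_image[OF lin V(1)] V(2) sub] by simp
qed

text \<open>An interior slice chart alone computes the tangent space: vectors tangent by any
  other slice chart are carried back into \<open>V\<close> by the transition map.\<close>

lemma tangent_space_interior_slice:
  assumes A: "smooth_atlas A" and c: "slice_chart A d S c V 0" and p: "p \<in> S" "p \<in> fst c"
  shows "tangent_space_of A d S p = {v. chart_deriv A c p v \<in> V}"
proof
  note I = C1_in_charts_id[OF A]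
  show "{v. chart_deriv A c p v \<in> V} \<subseteq> tangent_space_of A d S p"
    using c p(2) unfolding tangent_space_of_def by blast
  show "tangent_space_of A d S p \<subseteq> {v. chart_deriv A c p v \<in> V}"
  proof
    fix v assume "v \<in> tangent_space_of A d S p"
    then obtain c' V' w where c': "p \<in> fst c'" "slice_chart A d S c' V' w" "chart_deriv A c' p v \<in> V'"
      unfolding tangent_space_of_def by blast
    have C: "C1_chart A c" "C1_chart A c'" using c c'(2) by (auto simp: slice_chart_def)
    note cp = chart_at_C1[OF A, of p] chart_at_in(2)[OF A, of p]
    obtain u where u: "u \<in> V" "chart_deriv A c' p v = mderiv c c' id p u"
      using slice_transition[OF A c c'(2) p c'(1)] c'(3) by blast
    have "chart_deriv A c p v = mderiv c' c id p (chart_deriv A c' p v)"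
      using mderiv_chain[OF I I cp(1) C(2,1) cp(2), of v] p(2) c'(1)
      by (simp add: chart_deriv_mderiv)
    also have "\<dots> = u"
      using mderiv_inverse[OF I I _ C p(2), of u] c'(1) u(2) by simp
    finally show "v \<in> {v. chart_deriv A c p v \<in> V}" using u(1) by simp
  qed
qed

section \<open>Dynamics on the tangent bundle\<close>

lemma tangent_map_compose:
  assumes A: "smooth_atlas A" and "C1_in_charts A F" "C1_in_charts A G"
  shows "tangent_map A (G \<circ> F) p v = tangent_map A G (F p) (tangent_map A F p v)"
  unfolding tangent_map_mderiv
  using mderiv_chain[OF assms(2,3), of "chart_at A p" "chart_at A (F p)" "chart_at A (G (F p))" p v]
    chart_at_C1[OF A] chart_at_in[OF A] by simp

lemma tangent_map_linear:
  assumes A: "smooth_atlas A" and "C1_in_charts A F"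
  shows "linear (tangent_map A F p)"
  unfolding tangent_map_mderiv
  using mderiv_linear[OF assms(2)] chart_at_C1[OF A] chart_at_in[OF A] by blast

lemma tangent_map_id:
  assumes A: "smooth_atlas A"
  shows "tangent_map A id p v = v"
  using mderiv_id[OF C1_chart_is_chart[OF chart_at_C1[OF A]] chart_at_in(2)[OF A], of p v]
  by (simp add: tangent_map_mderiv)

lemma tangent_map_inverse:
  assumes A: "smooth_atlas A" and "C1_in_charts A F" "C1_in_charts A G" and "G \<circ> F = id"
  shows "tangent_map A G (F p) (tangent_map A F p v) = v"
  using tangent_map_compose[OF assms(1-3), of p v] tangent_map_id[OF A, of p v] assms(4) by simp

lemma tangent_map_in_charts:
  assumes A: "smooth_atlas A" and F: "C1_in_charts A F"
    and c: "C1_chart A c" "C1_chart A c'" and p: "p \<in> fst c" "F p \<in> fst c'"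
  shows "mderiv c c' F p (chart_deriv A c p v) = chart_deriv A c' (F p) (tangent_map A F p v)"
proof -
  note I = C1_in_charts_id[OF A]
  note a = chart_at_C1[OF A] and ain = chart_at_in(2)[OF A]
  have "mderiv c c' F p (chart_deriv A c p v) = mderiv (chart_at A p) c' F p v"
    using mderiv_chain[OF I F a c ain, of p v] p by (simp add: chart_deriv_mderiv)
  moreover have "chart_deriv A c' (F p) (tangent_map A F p v) = mderiv (chart_at A p) c' F p v"
    using mderiv_chain[OF F I a a c(2) ain ain, of p v] p
    by (simp add: chart_deriv_mderiv tangent_map_mderiv)
  ultimately show ?thesis by simp
qed

lemma chart_deriv_linear:
  assumes A: "smooth_atlas A" and c: "C1_chart A c" "p \<in> fst c"
  shows "linear (chart_deriv A c p)"
  unfolding chart_deriv_mderiv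
  using mderiv_linear[OF C1_in_charts_id[OF A] chart_at_C1[OF A] c(1) chart_at_in(2)[OF A]] c(2)
  by simp

lemma chart_deriv_surj:
  assumes A: "smooth_atlas A" and c: "C1_chart A c" "p \<in> fst c"
  obtains v where "chart_deriv A c p v = n"
proof -
  note I = C1_in_charts_id[OF A]
  have "chart_deriv A c p (chart_vector A c p n) = n"
    using mderiv_inverse[OF I I _ c(1) chart_at_C1[OF A] c(2), where v = n] chart_at_in(2)[OF A, of p]
    by (simp add: chart_deriv_mderiv chart_vector_mderiv)
  then show thesis by (rule that)
qed

text \<open>Local bounds, taken over a finite subcover.\<close>

lemma compact_uniform_bound:
  fixes P :: "'a::topological_space \<Rightarrow> real \<Rightarrow> bool"
  assumes K: "compact K"
    and loc: "\<And>x. x \<in> K \<Longrightarrow> \<exists>U B. open U \<and> x \<in> U \<and> (\<forall>q\<in>U. P q B)"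
    and mono: "\<And>q B B'. P q B \<Longrightarrow> B \<le> B' \<Longrightarrow> P q B'"
  obtains B where "B \<ge> b" "\<And>q. q \<in> K \<Longrightarrow> P q B"
proof -
  obtain U B where UB: "\<And>x. x \<in> K \<Longrightarrow> open (U x) \<and> x \<in> U x \<and> (\<forall>q\<in>U x. P q (B x))"
    using loc by metis
  obtain D where D: "D \<subseteq> K" "finite D" "K \<subseteq> (\<Union>x\<in>D. U x)"
    using compactE_image[OF K, of K U] UB by blast
  let ?B = "Max (insert b (B ` D))"
  show thesis
  proof (rule that[of ?B])
    show "?B \<ge> b" using D(2) by simp
    fix q assume "q \<in> K"
    then obtain x where x: "x \<in> D" "q \<in> U x" using D(3) by blast
    then have "B x \<le> ?B" using D(2) by simp
    then show "P q ?B" using UB D(1) x mono by blast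
  qed
qed

lemma tangent_map_bounded:
  assumes A: "smooth_atlas A" and g: "riemannian_metric A g" and F: "C1_in_charts A F"
    and K: "compact K"
  obtains B where "B \<ge> 1"
    "\<And>x v. x \<in> K \<Longrightarrow> metric_norm g (F x) (tangent_map A F x v) \<le> B * metric_norm g x v"
proof -
  let ?P = "\<lambda>x B. \<forall>v. metric_norm g (F x) (tangent_map A F x v) \<le> B * metric_norm g x v"
  have "\<exists>U B. open U \<and> x \<in> U \<and> (\<forall>q\<in>U. ?P q B)" for x
  proof -
    let ?a = "chart_at A x" and ?b = "chart_at A (F x)"
    note a = chart_at_C1[OF A] and ain = chart_at_in(2)[OF A]
    obtain U1 M1 where 1: "open U1" "x \<in> U1" "U1 \<subseteq> fst ?a" "M1 \<ge> 1"
      "\<And>q v. q \<in> U1 \<Longrightarrow> norm (chart_deriv A ?a q v) \<le> M1 * metric_norm g q v"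
      using metric_chart_comparison[OF A g a ain] by metis
    obtain U2 M2 where 2: "open U2" "F x \<in> U2" "U2 \<subseteq> fst ?b" "M2 \<ge> 1"
      "\<And>q v. q \<in> U2 \<Longrightarrow> metric_norm g q v \<le> M2 * norm (chart_deriv A ?b q v)"
      using metric_chart_comparison[OF A g a ain] by metis
    obtain U3 B3 where 3: "open U3" "x \<in> U3" "B3 > 0"
      "\<And>q v. q \<in> U3 \<Longrightarrow> norm (mderiv ?a ?b F q v) \<le> B3 * norm v"
      using mderiv_locally_bounded[OF F a a ain ain] by metis
    let ?U = "U1 \<inter> U3 \<inter> F -` U2"
    have "open ?U"
      using 1(1) 3(1) open_vimage[OF 2(1) C1_in_charts_continuous[OF F]] by blast
    moreover have "metric_norm g (F q) (tangent_map A F q v) \<le> M2 * (B3 * M1) * metric_norm g q v"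
      if q: "q \<in> ?U" for q v
    proof -
      have "metric_norm g (F q) (tangent_map A F q v) \<le>
          M2 * norm (chart_deriv A ?b (F q) (tangent_map A F q v))"
        using 2(5) q by simp
      also have "chart_deriv A ?b (F q) (tangent_map A F q v) = mderiv ?a ?b F q (chart_deriv A ?a q v)"
        by (rule tangent_map_in_charts[OF A F a a, symmetric]) (use q 1(3) 2(3) in auto)
      also have "M2 * norm \<dots> \<le> M2 * (B3 * norm (chart_deriv A ?a q v))"
        using 3(4)[of q] q 2(4) by (intro mult_left_mono) auto
      also have "\<dots> \<le> M2 * (B3 * (M1 * metric_norm g q v))"
        using 1(5)[of q v] q 2(4) 3(3) by (intro mult_left_mono) auto
      finally show ?thesis by (simp add: mult.assoc)
    qed
    ultimately show ?thesis using 1(2) 2(2) 3(2) by blast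
  qed
  moreover have "?P q B'" if "?P q B" "B \<le> B'" for q B B'
    using that(1) mult_right_mono[OF that(2) metric_norm_nonneg[OF g]] order_trans by blast
  ultimately obtain B where "B \<ge> 1" "\<And>q. q \<in> K \<Longrightarrow> ?P q B"
    using compact_uniform_bound[OF K, of ?P 1] by blast
  then show thesis using that by blast
qed

lemma invariant_splitting_funpow:
  assumes A: "smooth_atlas A" and f: "C1_in_charts A f" and inv: "f ` K = K"
    and spl: "invariant_splitting A f K Ec Eu" and x: "x \<in> K"
  shows "tangent_map A (f ^^ n) x ` Ec x = Ec ((f ^^ n) x) \<and>
    tangent_map A (f ^^ n) x ` Eu x = Eu ((f ^^ n) x) \<and> (f ^^ n) x \<in> K"
proof (induction n)
  case 0
  then show ?case using x tangent_map_id[OF A] by (simp add: id_def)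
next
  case (Suc n)
  have "tangent_map A (f ^^ Suc n) x ` E = tangent_map A f ((f ^^ n) x) ` tangent_map A (f ^^ n) x ` E" for E
    unfolding funpow.simps image_image
    by (intro image_cong refl tangent_map_compose[OF A C1_in_charts_funpow[OF A f] f])
  moreover have "(f ^^ Suc n) x = f ((f ^^ n) x)" by simp
  moreover have "f ((f ^^ n) x) \<in> K" using Suc inv by blast
  ultimately show ?case
    using Suc spl by (simp add: invariant_splitting_def del: funpow.simps)
qed

text \<open>The homogeneous forms of the two inequalities, which avoid normalising vectors.\<close>

lemma partially_hyperbolicE:
  assumes A: "smooth_atlas A" and g: "riemannian_metric A g" and f: "C1_in_charts A f"
    and ph: "partially_hyperbolic A g f K Ec Eu"
  obtains l C where "l > 1" "C > 0"
    "\<And>x v n. x \<in> K \<Longrightarrow> v \<in> Eu x \<Longrightarrow> n \<ge> 1 \<Longrightarrow>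
       C * l ^ n * metric_norm g x v \<le> metric_norm g ((f ^^ n) x) (tangent_map A (f ^^ n) x v)"
    "\<And>x u v n. x \<in> K \<Longrightarrow> u \<in> Ec x \<Longrightarrow> v \<in> Eu x \<Longrightarrow> n \<ge> 1 \<Longrightarrow>
       C * l ^ n * metric_norm g ((f ^^ n) x) (tangent_map A (f ^^ n) x u) * metric_norm g x v
       \<le> metric_norm g ((f ^^ n) x) (tangent_map A (f ^^ n) x v) * metric_norm g x u"
proof -
  obtain l C where lC: "l > 1" "C > 0"
    and ex: "\<And>x v n. x \<in> K \<Longrightarrow> v \<in> Eu x \<Longrightarrow> n \<ge> 1 \<Longrightarrow> metric_norm g x v = 1 \<Longrightarrow>
           metric_norm g ((f ^^ n) x) (tangent_map A (f ^^ n) x v) > C * l ^ n"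
    and dom: "\<And>x u v n. x \<in> K \<Longrightarrow> u \<in> Ec x \<Longrightarrow> v \<in> Eu x \<Longrightarrow> n \<ge> 1 \<Longrightarrow>
           metric_norm g x u = 1 \<Longrightarrow> metric_norm g x v = 1 \<Longrightarrow>
           metric_norm g ((f ^^ n) x) (tangent_map A (f ^^ n) x v)
             > C * l ^ n * metric_norm g ((f ^^ n) x) (tangent_map A (f ^^ n) x u)"
    using ph unfolding partially_hyperbolic_def by blast
  have sub: "subspace (Ec x)" "subspace (Eu x)" if "x \<in> K" for x
    using ph that unfolding partially_hyperbolic_def invariant_splitting_def by blast+
  define e where "e x v = v /\<^sub>R metric_norm g x v" for x v
  have e1: "metric_norm g x (e x v) = 1" if "v \<noteq> 0" for x v
    using metric_norm_pos[OF g that, of x] by (simp add: e_def metric_norm_scale[OF g])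
  have De: "metric_norm g ((f ^^ n) x) (tangent_map A (f ^^ n) x (e x v)) =
      metric_norm g ((f ^^ n) x) (tangent_map A (f ^^ n) x v) / metric_norm g x v" for n x v
    using metric_norm_nonneg[OF g, of x v]
    by (simp add: e_def linear_cmul[OF tangent_map_linear[OF A C1_in_charts_funpow[OF A f]]]
        metric_norm_scale[OF g] divide_inverse mult.commute)
  have D0: "tangent_map A (f ^^ n) x 0 = 0" for n x
    by (rule linear_0[OF tangent_map_linear[OF A C1_in_charts_funpow[OF A f]]])
  show thesis
  proof (rule that[OF lC])
    fix x v n assume x: "x \<in> K" and v: "v \<in> Eu x" and n: "n \<ge> (1::nat)"
    show "C * l ^ n * metric_norm g x v \<le> metric_norm g ((f ^^ n) x) (tangent_map A (f ^^ n) x v)"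
    proof (cases "v = 0")
      case True
      then show ?thesis by (simp add: D0 metric_norm_zero[OF g])
    next
      case False
      have "e x v \<in> Eu x" using sub(2)[OF x] v by (simp add: e_def subspace_scale)
      then have "C * l ^ n < metric_norm g ((f ^^ n) x) (tangent_map A (f ^^ n) x (e x v))"
        using ex[OF x _ n] e1[OF False] by blast
      then show ?thesis
        using metric_norm_pos[OF g False, of x] by (simp add: De pos_less_divide_eq)
    qed
  next
    fix x u v n assume x: "x \<in> K" and u: "u \<in> Ec x" and v: "v \<in> Eu x" and n: "n \<ge> (1::nat)"
    show "C * l ^ n * metric_norm g ((f ^^ n) x) (tangent_map A (f ^^ n) x u) * metric_norm g x v
       \<le> metric_norm g ((f ^^ n) x) (tangent_map A (f ^^ n) x v) * metric_norm g x u"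
    proof (cases "u = 0 \<or> v = 0")
      case True
      then show ?thesis by (auto simp: D0 metric_norm_zero[OF g])
    next
      case False
      have "e x v \<in> Eu x" "e x u \<in> Ec x"
        using sub[OF x] u v by (simp_all add: e_def subspace_scale)
      then have "C * l ^ n * metric_norm g ((f ^^ n) x) (tangent_map A (f ^^ n) x (e x u))
          < metric_norm g ((f ^^ n) x) (tangent_map A (f ^^ n) x (e x v))"
        using dom[OF x _ _ n] e1 False by blast
      then show ?thesis
        using metric_norm_pos[OF g, of u x] metric_norm_pos[OF g, of v x] False
        by (simp add: De field_simps)
    qed
  qed
qed

text \<open>The domination keeps the two bundles uniformly apart. Let \<open>v\<close> in \<open>Eu\<close> and \<open>- u\<close>
  in \<open>Ec\<close> have comparable length, and let \<open>m\<close> be such that \<open>C * l ^ m \<ge> 2\<close>. After \<open>m\<close> steps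
  \<open>v\<close> is definitely longer than \<open>- u\<close>, and at least twice as long as it was; so the image of
  \<open>u + v\<close> has a length comparable with that of \<open>v\<close>. Since the derivative of \<open>f ^^ m\<close> is bounded
  on \<open>K\<close>, already \<open>u + v\<close> could not be short. If the lengths are not comparable, the
  triangle inequality suffices.\<close>

lemma splitting_angle:
  assumes A: "smooth_atlas A" and g: "riemannian_metric A g" and f: "C1_in_charts A f"
    and K: "compact K" and ph: "partially_hyperbolic A g f K Ec Eu"
  obtains \<alpha> where "\<alpha> > 0"
    "\<And>x u v. x \<in> K \<Longrightarrow> u \<in> Ec x \<Longrightarrow> v \<in> Eu x \<Longrightarrow> \<alpha> * metric_norm g x v \<le> metric_norm g x (u + v)"
proof -
  obtain l C where lC: "l > 1" "C > 0"
    and ex: "\<And>x v n. x \<in> K \<Longrightarrow> v \<in> Eu x \<Longrightarrow> n \<ge> 1 \<Longrightarrow>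
       C * l ^ n * metric_norm g x v \<le> metric_norm g ((f ^^ n) x) (tangent_map A (f ^^ n) x v)"
    and dom: "\<And>x u v n. x \<in> K \<Longrightarrow> u \<in> Ec x \<Longrightarrow> v \<in> Eu x \<Longrightarrow> n \<ge> 1 \<Longrightarrow>
       C * l ^ n * metric_norm g ((f ^^ n) x) (tangent_map A (f ^^ n) x u) * metric_norm g x v
       \<le> metric_norm g ((f ^^ n) x) (tangent_map A (f ^^ n) x v) * metric_norm g x u"
    using partially_hyperbolicE[OF A g f ph] by blast
  \<comment> \<open>the expansion inequalities hold for positive exponents, hence the successor\<close>
  obtain m0 where "2 / C < l ^ m0" using real_arch_pow[OF lC(1)] by blast
  also have "l ^ m0 \<le> l ^ Suc m0" using lC(1) by simp
  finally have m2: "2 \<le> C * l ^ Suc m0" using lC(2) by (simp add: field_simps)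
  define m where "m = Suc m0"
  let ?F = "f ^^ m" and ?N = "metric_norm g"
  have F: "C1_in_charts A ?F" using C1_in_charts_funpow[OF A f] .
  obtain B where B: "B \<ge> 1" "\<And>x v. x \<in> K \<Longrightarrow> ?N (?F x) (tangent_map A ?F x v) \<le> B * ?N x v"
    using tangent_map_bounded[OF A g F K] by blast
  show thesis
  proof (rule that[of "1 / (2 * B)"])
    show "1 / (2 * B) > 0" using B(1) by simp
    fix x u v assume x: "x \<in> K" and u: "u \<in> Ec x" and v: "v \<in> Eu x"
    let ?D = "tangent_map A ?F x"
    note tri = metric_norm_triangle[OF g] and nn = metric_norm_nonneg[OF g]
    have neg: "?N p (- w) = ?N p w" for p w
      using metric_norm_scale[OF g, of p "-1" w] by simp
    have "?N x v \<le> 2 * B * ?N x (u + v)"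
    proof (cases "?N x u \<le> 3 / 2 * ?N x v")
      case False
      have "?N x u \<le> ?N x (u + v) + ?N x v"
        using tri[of x "u + v" "- v"] neg[of x v] by simp
      then have "?N x v \<le> 2 * ?N x (u + v)" using False by simp
      also have "\<dots> \<le> 2 * B * ?N x (u + v)"
        using B(1) nn[of x "u + v"] by (simp add: mult_right_mono)
      finally show ?thesis .
    next
      case True
      show ?thesis
      proof (cases "v = 0")
        case True
        then show ?thesis using B(1) nn[of x "u + v"] by (simp add: metric_norm_zero[OF g])
      next
        case False
        then have v0: "?N x v > 0" by (rule metric_norm_pos[OF g])
        let ?p = "?F x"
        have "2 * ?N ?p (?D u) * ?N x v \<le> C * l ^ m * ?N ?p (?D u) * ?N x v"
          using m2 nn by (intro mult_right_mono) (auto simp: m_def)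
        also have "\<dots> \<le> ?N ?p (?D v) * ?N x u"
          using dom[OF x u v, of m] by (simp add: m_def)
        also have "\<dots> \<le> ?N ?p (?D v) * (3 / 2 * ?N x v)"
          using True nn by (intro mult_left_mono) auto
        finally have Du: "?N ?p (?D u) \<le> 3 / 4 * ?N ?p (?D v)"
          using v0 by (simp add: field_simps)
        have "2 * ?N x v \<le> C * l ^ m * ?N x v"
          using m2 nn by (intro mult_right_mono) (auto simp: m_def)
        also have "\<dots> \<le> ?N ?p (?D v)" using ex[OF x v, of m] by (simp add: m_def)
        finally have Dv: "2 * ?N x v \<le> ?N ?p (?D v)" .
        have "?N ?p (?D v) \<le> ?N ?p (?D (u + v)) + ?N ?p (?D u)"
          using tri[of ?p "?D (u + v)" "- ?D u"] neg[of ?p "?D u"]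
          by (simp add: linear_add[OF tangent_map_linear[OF A F]])
        then show ?thesis using Du Dv B(2)[OF x, of "u + v"] by simp
      qed
    qed
    then show "1 / (2 * B) * ?N x v \<le> ?N x (u + v)"
      using B(1) by (simp add: field_simps)
  qed
qed

section \<open>Backward iterates approach the submanifold\<close>

text \<open>Write a vector at \<open>F x\<close> as the sum of its \<open>Ec\<close> and \<open>Eu\<close> components.
  The inverse \<open>G\<close> of \<open>F\<close> maps the first into the tangent space of the submanifold at \<open>x\<close>, whatever its length,
  and this image is the vector \<open>w\<close>. The second is not much longer than the whole vector, by the angle
  bound, and is contracted by \<open>G\<close>.\<close>

lemma transverse_contraction:
  assumes A: "smooth_atlas A" and g: "riemannian_metric A g"
    and F: "C1_in_charts A F" and G: "C1_in_charts A G" and GF: "G \<circ> F = id"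
    and c: "C1_chart A c" "F x \<in> fst c" and c': "C1_chart A c'" "x \<in> fst c'"
    and V: "{v. chart_deriv A c' x v \<in> V'} = Ec x"
    and inv: "tangent_map A F x ` Ec x = Ec (F x)" "tangent_map A F x ` Eu x = Eu (F x)"
    and sum: "{u + v | u v. u \<in> Ec (F x) \<and> v \<in> Eu (F x)} = UNIV"
    and expand: "\<And>v. v \<in> Eu x \<Longrightarrow> \<kappa> * metric_norm g x v \<le> metric_norm g (F x) (tangent_map A F x v)"
    and angle: "\<And>u v. u \<in> Ec (F x) \<Longrightarrow> v \<in> Eu (F x) \<Longrightarrow>
        \<alpha> * metric_norm g (F x) v \<le> metric_norm g (F x) (u + v)"
    and pos: "\<kappa> > 0" "\<alpha> > 0" "M \<ge> 0"
    and M: "\<And>v. norm (chart_deriv A c' x v) \<le> M * metric_norm g x v"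
      "\<And>v. metric_norm g (F x) v \<le> M * norm (chart_deriv A c (F x) v)"
  obtains w where "w \<in> V'" "norm (mderiv c c' G (F x) n - w) \<le> M\<^sup>2 / (\<kappa> * \<alpha>) * norm n"
proof -
  have GFx: "G (F x) = x" using GF by (metis comp_apply id_apply)
  obtain t where t: "chart_deriv A c (F x) t = n" using chart_deriv_surj[OF A c] by blast
  obtain u' v' where uv': "t = u' + v'" "u' \<in> Ec (F x)" "v' \<in> Eu (F x)"
  proof -
    have "t \<in> {u + v | u v. u \<in> Ec (F x) \<and> v \<in> Eu (F x)}" using sum by simp
    then show thesis using that by blast
  qed
  obtain u v where u: "u \<in> Ec x" "u' = tangent_map A F x u"
    and v: "v \<in> Eu x" "v' = tangent_map A F x v"
    using uv' inv by blast
  have "tangent_map A G (F x) t = u + v"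
    using tangent_map_inverse[OF A F G GF, of x "u + v"]
    by (simp add: uv' u v linear_add[OF tangent_map_linear[OF A F]])
  then have "mderiv c c' G (F x) n = chart_deriv A c' x (u + v)"
    using tangent_map_in_charts[OF A G c(1) c'(1) c(2), of t] c'(2) by (simp add: GFx t)
  then have eq: "mderiv c c' G (F x) n - chart_deriv A c' x u = chart_deriv A c' x v"
    by (simp add: linear_add[OF chart_deriv_linear[OF A c']])
  have "\<alpha> * (\<kappa> * metric_norm g x v) \<le> \<alpha> * metric_norm g (F x) v'"
    using expand[OF v(1)] pos v(2) by (intro mult_left_mono) auto
  also have "\<dots> \<le> metric_norm g (F x) t" using angle uv' by simp
  also have "\<dots> \<le> M * norm n" using M(2)[of t] t by simp
  finally have "metric_norm g x v \<le> M * norm n / (\<kappa> * \<alpha>)"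
    using pos by (simp add: field_simps)
  then have "M * metric_norm g x v \<le> M * (M * norm n / (\<kappa> * \<alpha>))"
    using pos(3) by (rule mult_left_mono)
  then have "norm (mderiv c c' G (F x) n - chart_deriv A c' x u) \<le> M\<^sup>2 / (\<kappa> * \<alpha>) * norm n"
    using M(1)[of v] by (simp add: eq power2_eq_square)
  moreover have "chart_deriv A c' x u \<in> V'" using u(1) V by blast
  ultimately show thesis using that by blast
qed

text \<open>Let \<open>z2\<close> be a point of the submanifold, in the chart \<open>c\<close>, that is nearest to \<open>z\<close>. Its image
  under \<open>G\<close> is again in the submanifold, that is, in \<open>V'\<close>. The difference of the images of
  \<open>z\<close> and \<open>z2\<close> is the derivative applied to \<open>z - z2\<close>, which is within a quarter of
  its length of \<open>V'\<close>, up to an error of another quarter.\<close>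

lemma slice_distance_halved:
  assumes G: "C1_in_charts A G"
    and c: "slice_chart A d S c V 0" "y \<in> fst c"
    and c': "slice_chart A d S c' V' 0" "G y \<in> fst c'"
    and y: "y \<in> S" and W: "open W" "y \<in> W" "\<And>z. z \<in> S \<Longrightarrow> z \<in> W \<Longrightarrow> G z \<in> S"
    and contr: "\<And>n. \<exists>w\<in>V'. norm (mderiv c c' G y n - w) \<le> 1 / 4 * norm n"
  shows "\<forall>\<^sub>F z in nhds y. infdist (snd c' (G z)) V' \<le> 1 / 2 * infdist (snd c z) V"
proof -
  have C: "C1_chart A c" "C1_chart A c'" and V: "subspace V" "subspace V'"
    using c c' by (auto simp: slice_chart_def)
  have ch: "is_chart c" "is_chart c'" using C C1_chart_is_chart by blast+
  let ?h = "local_rep c c' G"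
  have h: "?h (snd c q) = snd c' (G q)" if "q \<in> fst c" for q
    using local_rep_at[OF ch(1) that] .
  obtain r1 where r1: "r1 > 0"
    "\<And>y1 z. y1 \<in> ball (snd c y) r1 \<Longrightarrow> z \<in> ball (snd c y) r1 \<Longrightarrow>
       norm (?h z - ?h y1 - mderiv c c' G y (z - y1)) \<le> 1 / 4 * norm (z - y1)"
    using C1_at_strict_derivative[OF C1_in_chartsD[OF G C c(2) c'(2)], of "1/4"]
    unfolding mderiv_def by auto
  let ?O = "fst c \<inter> W \<inter> G -` fst c'"
  have "open ?O"
    using chart_open(1)[OF ch(1)] W(1)
      open_vimage[OF chart_open(1)[OF ch(2)] C1_in_charts_continuous[OF G]] by blast
  then have "open (snd c ` ?O)" by (rule open_chart_image[OF ch(1)]) auto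
  moreover have "snd c y \<in> snd c ` ?O" using c(2) c'(2) W(2) by blast
  ultimately obtain r2 where r2: "r2 > 0" "ball (snd c y) r2 \<subseteq> snd c ` ?O"
    by (meson open_contains_ball)
  define r where "r = min r1 r2"
  have r: "r > 0" using r1(1) r2(1) by (simp add: r_def)
  let ?U = "fst c \<inter> snd c -` ball (snd c y) (r / 2)"
  have "infdist (snd c' (G z)) V' \<le> 1 / 2 * infdist (snd c z) V" if z: "z \<in> ?U" for z
  proof -
    have yV: "snd c y \<in> V" using slice_chart_iff[OF c] y by blast
    obtain z2 where z2: "z2 \<in> V" "infdist (snd c z) V = dist (snd c z) z2"
      using infdist_attains_inf[OF closed_subspace[OF V(1)], of "snd c z"] yV by blast
    \<comment> \<open>half the radius, because the nearest point may be twice as far from the centre\<close>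
    have zy: "dist (snd c z) (snd c y) < r / 2" using z by (simp add: dist_commute)
    have "dist (snd c z) z2 \<le> dist (snd c z) (snd c y)"
      using infdist_le[OF yV, of "snd c z"] z2(2) by simp
    then have "dist (snd c y) z2 < r"
      using zy dist_triangle[of "snd c y" z2 "snd c z"] by (simp add: dist_commute)
    then have z2b: "z2 \<in> ball (snd c y) r1" "z2 \<in> ball (snd c y) r2" by (auto simp: r_def)
    have zb: "snd c z \<in> ball (snd c y) r1" using zy r by (simp add: r_def dist_commute)
    obtain q where q: "z2 = snd c q" "q \<in> fst c" "q \<in> W" "G q \<in> fst c'"
      using r2(2) z2b(2) by blast
    have "q \<in> S" using slice_chart_iff[OF c(1) q(2)] z2(1) q(1) by simp
    then have Gq: "?h z2 \<in> V'"
      using W(3) q slice_chart_iff[OF c'(1) q(4)] by (simp add: h)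
    let ?n = "snd c z - z2"
    obtain w where w: "w \<in> V'" "norm (mderiv c c' G y ?n - w) \<le> 1 / 4 * norm ?n"
      using contr by blast
    have "infdist (snd c' (G z)) V' \<le> dist (?h (snd c z)) (?h z2 + w)"
      using infdist_le[OF subspace_add[OF V(2) Gq w(1)]] z by (simp add: h)
    also have "\<dots> = norm ((?h (snd c z) - ?h z2 - mderiv c c' G y ?n) + (mderiv c c' G y ?n - w))"
      by (simp add: dist_norm algebra_simps)
    also have "\<dots> \<le> norm (?h (snd c z) - ?h z2 - mderiv c c' G y ?n) + norm (mderiv c c' G y ?n - w)"
      by (rule norm_triangle_ineq)
    also have "\<dots> \<le> 1 / 2 * norm ?n"
      using r1(2)[OF z2b(1) zb] w(2) by simp
    finally show ?thesis by (simp add: z2(2) dist_norm)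
  qed
  moreover have "open ?U" using open_chart_preimage[OF ch(1) open_ball] .
  moreover have "y \<in> ?U" using c(2) r by simp
  ultimately show ?thesis unfolding eventually_nhds by blast
qed

text \<open>What is chosen around each point of \<open>K\<close>. A single constant serves for all bounds, and
  \<open>C\<close> is closed so that a point outside it has a neighbourhood outside it.\<close>

definition slice_box ::
  "('m::topological_space, 'e::euclidean_space) chart set \<Rightarrow> ('m \<Rightarrow> 'e \<Rightarrow> 'e \<Rightarrow> real) \<Rightarrow> nat \<Rightarrow> 'm set
     \<Rightarrow> ('m, 'e) chart \<Rightarrow> 'e set \<Rightarrow> 'm set \<Rightarrow> real \<Rightarrow> bool" where
  "slice_box A g d S c V C M \<longleftrightarrow> slice_chart A d S c V 0 \<and> closed C \<and> C \<subseteq> fst c \<and> M \<ge> 1 \<and>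
     (\<forall>q\<in>C. norm (snd c q) \<le> M \<and> (\<forall>v. norm (chart_deriv A c q v) \<le> M * metric_norm g q v \<and>
        metric_norm g q v \<le> M * norm (chart_deriv A c q v)))"

lemma slice_boxD:
  assumes "slice_box A g d S c V C M"
  shows "slice_chart A d S c V 0" "closed C" "C \<subseteq> fst c" "M \<ge> 1"
    "q \<in> C \<Longrightarrow> norm (snd c q) \<le> M"
    "q \<in> C \<Longrightarrow> norm (chart_deriv A c q v) \<le> M * metric_norm g q v"
    "q \<in> C \<Longrightarrow> metric_norm g q v \<le> M * norm (chart_deriv A c q v)"
  using assms unfolding slice_box_def by blast+

text \<open>The box is the preimage of a closed ball. It is compact, hence closed because the manifold is
  Hausdorff.\<close>

lemma slice_box_exists:
  fixes A :: "('m::{t2_space,second_countable_topology}, 'e::euclidean_space) chart set"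
  assumes A: "smooth_atlas A" and g: "riemannian_metric A g"
    and x: "x \<in> manifold_interior A d S"
  shows "\<exists>c V C M. slice_box A g d S c V C M \<and> x \<in> interior C"
proof -
  obtain c V where c: "x \<in> fst c" "slice_chart A d S c V 0"
    using x unfolding manifold_interior_def by blast
  have C: "C1_chart A c" using c(2) by (simp add: slice_chart_def)
  have ch: "is_chart c" using C C1_chart_is_chart by blast
  obtain U M where U: "open U" "x \<in> U" "U \<subseteq> fst c" "M \<ge> 1"
    "\<And>q v. q \<in> U \<Longrightarrow> norm (chart_deriv A c q v) \<le> M * metric_norm g q v"
    "\<And>q v. q \<in> U \<Longrightarrow> metric_norm g q v \<le> M * norm (chart_deriv A c q v)"
    using metric_chart_comparison[OF A g C c(1)] by blast
  have "open (snd c ` U)" "snd c x \<in> snd c ` U" using open_chart_image[OF ch U(1,3)] U(2) by auto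
  then obtain r where r: "r > 0" "cball (snd c x) r \<subseteq> snd c ` U"
    using open_contains_cball by blast
  let ?C = "chart_inv c ` cball (snd c x) r"
  have inU: "?C \<subseteq> U"
  proof
    fix q assume "q \<in> ?C"
    then obtain z where z: "z \<in> cball (snd c x) r" "q = chart_inv c z" by blast
    then obtain q' where "q' \<in> U" "z = snd c q'" using r(2) by blast
    then show "q \<in> U" using z(2) chart_inv_left[OF ch] U(3) by auto
  qed
  have sub: "cball (snd c x) r \<subseteq> snd c ` fst c" using r(2) U(3) by blast
  have "compact ?C"
    using compact_continuous_image[OF continuous_on_subset[OF chart_inv_continuous[OF ch] sub]]
    by simp
  then have cl: "closed ?C" by (rule compact_imp_closed)
  have int: "x \<in> interior ?C"
  proof (rule interiorI)
    show "open (fst c \<inter> snd c -` ball (snd c x) r)" using open_chart_preimage[OF ch open_ball] .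
    show "x \<in> fst c \<inter> snd c -` ball (snd c x) r" using c(1) r(1) by simp
    show "fst c \<inter> snd c -` ball (snd c x) r \<subseteq> ?C"
    proof
      fix q assume q: "q \<in> fst c \<inter> snd c -` ball (snd c x) r"
      then have "q = chart_inv c (snd c q)" using chart_inv_left[OF ch] by simp
      moreover have "snd c q \<in> cball (snd c x) r" using q by simp
      ultimately show "q \<in> ?C" by blast
    qed
  qed
  have bd: "norm (snd c q) \<le> norm (snd c x) + r" if "q \<in> ?C" for q
  proof -
    obtain z where z: "z \<in> cball (snd c x) r" "q = chart_inv c z" using \<open>q \<in> ?C\<close> by blast
    have "snd c q = z" using z sub chart_inv_right[of z c] by blast
    then show ?thesis using z(1) norm_triangle_ineq2[of z "snd c x"]
      by (simp add: dist_norm norm_minus_commute)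
  qed
  define M' where "M' = max M (norm (snd c x) + r)"
  have M': "M * a \<le> M' * a" if "a \<ge> 0" for a
    using that by (simp add: M'_def mult_right_mono)
  have "slice_box A g d S c V ?C M'"
    unfolding slice_box_def
  proof (intro conjI ballI allI)
    fix q v assume q: "q \<in> ?C"
    then have "q \<in> U" using inU by blast
    then show "norm (chart_deriv A c q v) \<le> M' * metric_norm g q v"
      "metric_norm g q v \<le> M' * norm (chart_deriv A c q v)"
      using order_trans[OF U(5) M'[OF metric_norm_nonneg[OF g]]] order_trans[OF U(6) M'[OF norm_ge_zero]]
      by blast+
    show "norm (snd c q) \<le> M'" using bd[OF q] by (simp add: M'_def)
  qed (use c(2) cl inU U(3,4) in \<open>auto simp: M'_def\<close>)
  then show ?thesis using int by blast
qed

text \<open>Near \<open>K\<close>, points of \<open>S\<close> have their preimages in \<open>S\<close>; as \<open>K\<close> is invariant this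
  can be repeated any finite number of times.\<close>

lemma locally_invariant_backward:
  fixes f :: "'m::topological_space \<Rightarrow> 'm"
  assumes bij: "bij f" and cont: "continuous_on UNIV (inv f)" and K: "f ` K = K"
    and loc: "locally_invariant f K S"
  obtains W where "open W" "K \<subseteq> W" "\<And>z. z \<in> S \<Longrightarrow> z \<in> W \<Longrightarrow> (inv f ^^ n) z \<in> S"
proof -
  obtain W0 where W0: "openin (top_of_set S) W0" "K \<subseteq> W0" "W0 \<subseteq> f ` S \<inter> S"
    using loc unfolding locally_invariant_def by blast
  then obtain W1 where W1: "open W1" "W0 = S \<inter> W1" unfolding openin_open by blast
  have step: "inv f z \<in> S" if "z \<in> S" "z \<in> W1" for z
    using that W0(3) W1(2) bij_is_inj[OF bij] by auto
  have "\<exists>W. open W \<and> K \<subseteq> W \<and> (\<forall>z\<in>S. z \<in> W \<longrightarrow> (inv f ^^ n) z \<in> S)"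
  proof (induction n)
    case 0
    show ?case by (rule exI[of _ UNIV]) auto
  next
    case (Suc n)
    then obtain W where W: "open W" "K \<subseteq> W" "\<And>z. z \<in> S \<Longrightarrow> z \<in> W \<Longrightarrow> (inv f ^^ n) z \<in> S"
      by blast
    show ?case
    proof (intro exI[of _ "W1 \<inter> inv f -` W"] conjI ballI impI)
      show "open (W1 \<inter> inv f -` W)" using W1(1) open_vimage[OF W(1) cont] by blast
      show "K \<subseteq> W1 \<inter> inv f -` W"
      proof
        fix x assume x: "x \<in> K"
        then obtain x' where "x' \<in> K" "x = f x'" using K by blast
        then have "inv f x \<in> K" using bij_is_inj[OF bij] by simp
        then show "x \<in> W1 \<inter> inv f -` W" using x W(2) W0(2) W1(2) by blast
      qed
      show "(inv f ^^ Suc n) z \<in> S" if "z \<in> S" "z \<in> W1 \<inter> inv f -` W" for z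
        using that step W(3) by (simp add: funpow_swap1)
    qed
  qed
  then show thesis using that by blast
qed

lemma maximal_invariant_set_forward:
  assumes bij: "bij f" and x: "x \<in> maximal_invariant_set f U"
  shows "(f ^^ n) x \<in> U"
proof -
  have "x \<in> (inv f ^^ n) ` U" if "n > 0"
    using x that unfolding maximal_invariant_set_def int_iterate_def
    by (auto dest!: spec[of _ "- int n"])
  moreover have "x \<in> U"
    using x unfolding maximal_invariant_set_def int_iterate_def by (auto dest!: spec[of _ 0])
  moreover have "(f ^^ n) ((inv f ^^ n) u) = u" for u
    by (metis bij bij_fn bij_is_surj inv_fn surj_f_inv_f)
  ultimately show ?thesis by (cases "n = 0") auto
qed

section \<open>The maximal invariant set\<close>

theorem corollary1p2:
  fixes A :: "('m::{t2_space,second_countable_topology}, 'e::euclidean_space) chart set"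
    and g :: "'m \<Rightarrow> 'e \<Rightarrow> 'e \<Rightarrow> real"
    and f :: "'m \<Rightarrow> 'm"
    and K S :: "'m set"
    and Ec Eu :: "'m \<Rightarrow> 'e set"
    and d :: nat
  assumes "smooth_atlas A"
    and "riemannian_metric A g"
    and "C1_diffeomorphism A f"
    and "compact K" and "f ` K = K"
    and "partially_hyperbolic A g f K Ec Eu"
    and "compact S" and "C1_submanifold_with_boundary A d S"
    and "K \<subseteq> manifold_interior A d S"
    and "\<And>x. x \<in> K \<Longrightarrow> tangent_space_of A d S x = Ec x"
    and "locally_invariant f K S"
  shows "\<exists>U. open U \<and> K \<subseteq> U \<and> maximal_invariant_set f U \<subseteq> manifold_interior A d S"
proof -
  note A = assms(1) and g = assms(2)
  have bij: "bij f" and f: "C1_in_charts A f" and f': "C1_in_charts A (inv f)"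
    using assms(3) C1_map_in_charts[OF A] by (auto simp: C1_diffeomorphism_def)
  have spl: "invariant_splitting A f K Ec Eu"
    using assms(6) by (simp add: partially_hyperbolic_def)
  have KS: "K \<subseteq> S" using assms(9) by (auto simp: manifold_interior_def)

  have "\<exists>c V C M. slice_box A g d S c V C M \<and> x \<in> interior C" if "x \<in> K" for x
    by (rule slice_box_exists[OF A g subsetD[OF assms(9) that]])
  then obtain c V C M where
    box: "\<And>x. x \<in> K \<Longrightarrow> slice_box A g d S (c x) (V x) (C x) (M x)" and
    int: "\<And>x. x \<in> K \<Longrightarrow> x \<in> interior (C x)"
    by metis
  note sl = slice_boxD(1)[OF box] and cl = slice_boxD(2)[OF box] and sub = slice_boxD(3)[OF box]
    and M1 = slice_boxD(4)[OF box] and RC = slice_boxD(5)[OF box] and MC = slice_boxD(6,7)[OF box]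
  obtain D where D: "D \<subseteq> K" "finite D" "K \<subseteq> (\<Union>x\<in>D. interior (C x))"
    using compactE_image[OF assms(4), of K "\<lambda>x. interior (C x)"] int by blast
  \<comment> \<open>one constant for all boxes of the finite cover\<close>
  define M' where "M' = 1 + (\<Sum>x\<in>D. M x)"
  have M'le: "M x \<le> M'" if "x \<in> D" for x
  proof -
    have "0 \<le> M y" if "y \<in> D" for y using M1[of y] D(1) that by auto
    then have "M x \<le> (\<Sum>x\<in>D. M x)" using that D(2) by (intro member_le_sum) auto
    then show ?thesis by (simp add: M'_def)
  qed
  have M'pos: "M' > 0"
    unfolding M'_def using M1 D(1) by (intro add_pos_nonneg sum_nonneg) (auto intro: order_trans[OF zero_le_one])

  obtain l a where la: "l > 1" "a > 0"
    and ex: "\<And>x v n. x \<in> K \<Longrightarrow> v \<in> Eu x \<Longrightarrow> n \<ge> 1 \<Longrightarrow>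
       a * l ^ n * metric_norm g x v \<le> metric_norm g ((f ^^ n) x) (tangent_map A (f ^^ n) x v)"
    using partially_hyperbolicE[OF A g f assms(6)] by metis
  obtain \<alpha> where \<alpha>: "\<alpha> > 0"
    "\<And>x u v. x \<in> K \<Longrightarrow> u \<in> Ec x \<Longrightarrow> v \<in> Eu x \<Longrightarrow> \<alpha> * metric_norm g x v \<le> metric_norm g x (u + v)"
    using splitting_angle[OF A g f assms(4,6)] by blast
  \<comment> \<open>\<open>N\<close> so large that the contraction beats the angle and the change of norms\<close>
  obtain N0 where "4 * M'\<^sup>2 / (a * \<alpha>) < l ^ N0" using real_arch_pow[OF la(1)] by blast
  also have "l ^ N0 \<le> l ^ Suc N0" using la(1) by simp
  finally have "4 * M'\<^sup>2 < l ^ Suc N0 * (a * \<alpha>)"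
    using la(2) \<alpha>(1) by (simp only: pos_divide_less_eq mult_pos_pos)
  define N where "N = Suc N0"
  have small: "M'\<^sup>2 / (a * l ^ N * \<alpha>) \<le> 1 / 4"
    using \<open>4 * M'\<^sup>2 < l ^ Suc N0 * (a * \<alpha>)\<close> la \<alpha>(1) unfolding N_def[symmetric]
    by (simp add: divide_le_eq mult_ac)
  define F where "F = f ^^ N"
  define G where "G = inv f ^^ N"
  have F: "C1_in_charts A F" and G: "C1_in_charts A G"
    using C1_in_charts_funpow[OF A] f f' by (auto simp: F_def G_def)
  have Ginv: "G = inv F" unfolding F_def G_def using inv_fn[OF bij] by metis
  have bF: "bij F" unfolding F_def using bij_fn[OF bij] .
  have GF: "G \<circ> F = id" unfolding Ginv using bij_is_inj[OF bF] by simp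
  have FG: "F (G x) = x" for x unfolding Ginv using bij_is_surj[OF bF] by (simp add: surj_f_inv_f)
  have FK: "F ` K = K"
    unfolding F_def by (induction N) (use assms(5) in \<open>auto simp flip: image_image\<close>)
  have GK: "G y \<in> K" if "y \<in> K" for y
    using that FK GF by (metis comp_apply id_apply imageE)
  obtain W where W: "open W" "K \<subseteq> W" "\<And>z. z \<in> S \<Longrightarrow> z \<in> W \<Longrightarrow> G z \<in> S"
    using locally_invariant_backward[OF bij C1_in_charts_continuous[OF f'] assms(5,11)]
    unfolding G_def by metis
  define \<rho> where "\<rho> x z = infdist (snd (c x) z) (V x)" for x z
  have Ec: "{v. chart_deriv A (c x) q v \<in> V x} = Ec q" if "x \<in> D" "q \<in> K" "q \<in> C x" for x q
    using tangent_space_interior_slice[OF A sl, of x q] assms(10)[OF that(2)] that D(1) KS sub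
    by blast
  define P where "P z \<longleftrightarrow> (\<forall>j\<in>D. z \<in> C j \<longrightarrow> (\<exists>i\<in>D. G z \<in> C i \<and> \<rho> i (G z) \<le> 1 / 2 * \<rho> j z))" for z

  \<comment> \<open>the chart \<open>j\<close> of \<open>z\<close> is arbitrary, so that such steps can be composed\<close>
  have near: "\<forall>\<^sub>F z in nhds y. P z" if y: "y \<in> K" for y
  proof -
    define x where "x = G y"
    have x: "x \<in> K" "F x = y" using GK[OF y] FG by (auto simp: x_def)
    obtain i where i: "i \<in> D" "x \<in> interior (C i)" using x D(3) by blast
    have iC: "x \<in> C i" using i(2) interior_subset by blast
    have iK: "i \<in> K" using i D by blast
    have "open (G -` interior (C i))"
      using open_vimage[OF open_interior C1_in_charts_continuous[OF G]] .
    then have ev_i: "\<forall>\<^sub>F z in nhds y. G z \<in> C i"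
      using i(2) interior_subset unfolding eventually_nhds x_def by (metis subsetD vimage_eq)
    have "\<forall>\<^sub>F z in nhds y. z \<in> C j \<longrightarrow> \<rho> i (G z) \<le> 1 / 2 * \<rho> j z" if j: "j \<in> D" for j
    proof (cases "y \<in> C j")
      case False
      have "\<forall>\<^sub>F z in nhds y. z \<in> - C j"
        \<comment> \<open>boxes are closed: one that misses \<open>y\<close> does not reach points near \<open>y\<close>\<close>
        using cl[of j] j D(1) False by (intro eventually_nhds_in_open) auto
      then show ?thesis by eventually_elim auto
    next
      case True
      have jK: "j \<in> K" using j D by blast
      have C1: "C1_chart A (c j)" "C1_chart A (c i)"
        using sl[OF jK] sl[OF iK] by (auto simp: slice_chart_def)
      have yj: "y \<in> fst (c j)" and xi: "x \<in> fst (c i)" using sub[OF jK] sub[OF iK] True iC by auto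
      have inv: "tangent_map A F x ` Ec x = Ec (F x)" "tangent_map A F x ` Eu x = Eu (F x)"
        using invariant_splitting_funpow[OF A f assms(5) spl x(1), of N] by (auto simp: F_def)
      have "{u + v | u v. u \<in> Ec (F x) \<and> v \<in> Eu (F x)} = UNIV"
        using spl y unfolding invariant_splitting_def x(2) by blast
      note contr = transverse_contraction[OF A g F G GF C1(1) _ C1(2) xi
          Ec[OF i(1) x(1) iC] inv this]
      have "\<exists>w\<in>V i. norm (mderiv (c j) (c i) G y n - w) \<le> 1 / 4 * norm n" for n
      proof -
        obtain w where w: "w \<in> V i"
          "norm (mderiv (c j) (c i) G (F x) n - w) \<le> M'\<^sup>2 / (a * l ^ N * \<alpha>) * norm n"
        proof (rule contr)
          show "F x \<in> fst (c j)" using yj x(2) by simp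
          show "a * l ^ N * metric_norm g x v \<le> metric_norm g (F x) (tangent_map A F x v)"
            if "v \<in> Eu x" for v
            using ex[OF x(1) that, of N] by (simp add: F_def N_def)
          show "\<alpha> * metric_norm g (F x) v \<le> metric_norm g (F x) (u + v)"
            if "u \<in> Ec (F x)" "v \<in> Eu (F x)" for u v
            using \<alpha>(2) that x(2) y by blast
          show "norm (chart_deriv A (c i) x v) \<le> M' * metric_norm g x v" for v
            using order_trans[OF MC(1)[OF iK iC, of v]
                mult_right_mono[OF M'le[OF i(1)] metric_norm_nonneg[OF g, of x v]]] .
          show "metric_norm g (F x) v \<le> M' * norm (chart_deriv A (c j) (F x) v)" for v
            using order_trans[OF MC(2)[OF jK True, of v] mult_right_mono[OF M'le[OF j] norm_ge_zero]]
            by (simp add: x(2))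
        qed (use la \<alpha>(1) M'pos in auto)
        have "norm (mderiv (c j) (c i) G y n - w) \<le> 1 / 4 * norm n"
          using order_trans[OF w(2) mult_right_mono[OF small norm_ge_zero]] x(2) by simp
        then show ?thesis using w(1) by blast
      qed
      then have "\<forall>\<^sub>F z in nhds y. \<rho> i (G z) \<le> 1 / 2 * \<rho> j z"
        unfolding \<rho>_def using xi y KS W
        by (intro slice_distance_halved[OF G sl[OF jK] yj sl[OF iK] _ _ W(1)]) (auto simp: x_def)
      then show ?thesis by eventually_elim auto
    qed
    then have "\<forall>\<^sub>F z in nhds y. \<forall>j\<in>D. z \<in> C j \<longrightarrow> \<rho> i (G z) \<le> 1 / 2 * \<rho> j z"
      using D(2) by (simp add: eventually_ball_finite)
    then show ?thesis
      using ev_i by eventually_elim (use i(1) in \<open>auto simp: P_def\<close>)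
  qed

  define U where "U = (\<Union>{Q. open Q \<and> (\<forall>z\<in>Q. P z)}) \<inter> (\<Union>x\<in>D. interior (C x))"
  have UP: "P z" "\<exists>j\<in>D. z \<in> C j" if "z \<in> U" for z
    using that interior_subset unfolding U_def by blast+
  \<comment> \<open>from the bounded distance at time \<open>n * N\<close> back to time 0, halving it \<open>n\<close> times\<close>
  have decay: "\<exists>i\<in>D. x \<in> C i \<and> \<rho> i x \<le> M' / 2 ^ n" if "\<And>k. (f ^^ k) x \<in> U" for n x
    using that
  proof (induction n arbitrary: x)
    case 0
    obtain i where i: "i \<in> D" "x \<in> C i" using UP(2) 0[of 0] by auto
    have iK: "i \<in> K" using i D by blast
    have "0 \<in> V i" using sl[OF iK] by (auto simp: slice_chart_def subspace_0)
    then have "\<rho> i x \<le> dist (snd (c i) x) 0" unfolding \<rho>_def by (rule infdist_le)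
    then have "\<rho> i x \<le> M'" using RC[OF iK i(2)] M'le[OF i(1)] by simp
    then show ?case using i by auto
  next
    case (Suc n)
    have "(f ^^ k) (F x) \<in> U" for k
      using Suc.prems[of "k + N"] by (simp add: F_def funpow_add)
    then obtain j where j: "j \<in> D" "F x \<in> C j" "\<rho> j (F x) \<le> M' / 2 ^ n" using Suc.IH by blast
    have "P (F x)" using UP(1) Suc.prems[of N] by (simp add: F_def)
    moreover have "G (F x) = x" using GF by (metis comp_apply id_apply)
    ultimately obtain i where i: "i \<in> D" "x \<in> C i" "\<rho> i x \<le> 1 / 2 * \<rho> j (F x)"
      using j by (auto simp: P_def)
    have "\<rho> i x \<le> 1 / 2 * (M' / 2 ^ n)" using i(3) j(3) by linarith
    also have "\<dots> = M' / 2 ^ Suc n" by simp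
    finally have "\<rho> i x \<le> M' / 2 ^ Suc n" .
    then show ?case using i by blast
  qed
  show ?thesis
  proof (intro exI[of _ U] conjI subsetI)
    show "open U" unfolding U_def by auto
    show "x \<in> U" if "x \<in> K" for x
      using near[OF that] that D(3) unfolding U_def eventually_nhds by blast
    fix x assume "x \<in> maximal_invariant_set f U"
    then have orb: "(f ^^ k) x \<in> U" for k by (rule maximal_invariant_set_forward[OF bij])
    have "\<exists>i\<in>D. x \<in> C i \<and> \<rho> i x = 0"
    proof (rule ccontr)
      assume *: "\<not> ?thesis"
      let ?I = "{i\<in>D. x \<in> C i}"
      have fin: "finite (insert 1 ((\<lambda>i. \<rho> i x) ` ?I))" using D(2) by simp
      \<comment> \<open>the element 1 only serves to have a minimum of a nonempty set\<close>
      define \<delta> where "\<delta> = Min (insert 1 ((\<lambda>i. \<rho> i x) ` ?I))"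
      have "\<rho> i x > 0" if "i \<in> ?I" for i
        using that * infdist_nonneg[of "snd (c i) x" "V i"] by (auto simp: \<rho>_def less_le)
      then have "\<delta> > 0" unfolding \<delta>_def using fin by auto
      moreover have "(\<lambda>n. M' / 2 ^ n) \<longlonglongrightarrow> 0"
        using tendsto_mult_right_zero[OF LIMSEQ_realpow_zero[of "1/2"], of M']
        by (simp add: power_divide)
      ultimately obtain n where "M' / 2 ^ n < \<delta>"
        by (metis (no_types, lifting) eventually_sequentially order_refl order_tendstoD(2))
      moreover obtain i where "i \<in> ?I" "\<rho> i x \<le> M' / 2 ^ n" using decay[OF orb] by blast
      moreover have "\<delta> \<le> \<rho> i x" if "i \<in> ?I" for i unfolding \<delta>_def using fin that by simp
      ultimately show False by fastforce
    qed
    then obtain i where i: "i \<in> D" "x \<in> C i" "\<rho> i x = 0" by blast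
    have iK: "i \<in> K" using i D by blast
    have xi: "x \<in> fst (c i)" using sub[OF iK] i(2) by blast
    have V: "subspace (V i)" using sl[OF iK] by (simp add: slice_chart_def)
    have "snd (c i) x \<in> V i"
      using i(3) in_closed_iff_infdist_zero[OF closed_subspace[OF V]] subspace_0[OF V]
      unfolding \<rho>_def by blast
    then have "x \<in> S" using slice_chart_iff[OF sl[OF iK] xi] by simp
    then show "x \<in> manifold_interior A d S"
      unfolding manifold_interior_def using sl[OF iK] xi by blast
  qed
qed

end
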